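(* Let $t>0$ and let $B_1,B_2,\dots$ be independent standard Brownian motions started at $0$. For $n\ge1$ let ${}^nT_{0,t}$ be the $n$-th iterated last zero-crossing time, i.e. ${}^nT_{0,t}=\tau_1$, where $\tau_n=\sup\{s<t:B_n(s)=0\}$ and $\tau_j=\sup\{s<\tau_{j+1}:B_j(s)=0\}$ for $j=n-1,\dots,1$. Then for all integers $m\ge1$ and $n\ge1$, $$\mathbb E\big[({}^nT_{0,t})^m\big]=\left[\frac{\Gamma(m+\frac12)\Gamma(\frac12)}{\Gamma(m+1)}\right]^n\frac{t^m}{\pi^n}=\left[\binom{2m}{m}\frac1{2^{2m}}\right]^nt^m .$$ In particular $\mathbb E[{}^nT_{0,t}]=t/2^n$ and $\mathbb E[({}^nT_{0,t})^2]=(3/8)^nt^2$, so ${}^nT_{0,t}\to0$ in mean square as $n\to\infty$.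
   Context: Suprema are over $s\ge 0$. Thus ${}^nT_{0,t}$ involves exactly $n$ independent driftless Brownian motions: ${}^1T_{0,t}$ is the last zero before $t$ of a Brownian motion, and each further iteration takes the last zero of an independent Brownian motion before the previously obtained random time. *)

theory Defs
  imports "HOL-Probability.Probability"
begin

text \<open>Only the times \<open>s \<ge> 0\<close> matter; the process is a total function on \<^typ>\<open>real\<close>. Starting
  point and path continuity are required almost surely.\<close>

definition standard_brownian_motion :: "'a measure \<Rightarrow> (real \<Rightarrow> 'a \<Rightarrow> real) \<Rightarrow> bool" where
  "standard_brownian_motion M X \<longleftrightarrow>
     (\<forall>s\<ge>0. X s \<in> borel_measurable M) \<and>
     (AE \<omega> in M. X 0 \<omega> = 0) \<and>
     (\<forall>(k::nat) (u::nat \<Rightarrow> real). 0 \<le> u 0 \<longrightarrow> (\<forall>i<k. u i < u (Suc i)) \<longrightarrow>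
        prob_space.indep_vars M (\<lambda>_. borel) (\<lambda>i \<omega>. X (u (Suc i)) \<omega> - X (u i) \<omega>) {..<k}) \<and>
     (\<forall>s u. 0 \<le> s \<longrightarrow> s < u \<longrightarrow>
        distributed M lborel (\<lambda>\<omega>. X u \<omega> - X s \<omega>) (normal_density 0 (sqrt (u - s)))) \<and>
     (AE \<omega> in M. continuous_on {0..} (\<lambda>s. X s \<omega>))"

text \<open>Independence of whole processes: independence of the path-valued random variables, with
  the product sigma-algebra on functions \<open>[0, \<infinity>) \<rightarrow> \<real>\<close>.\<close>

definition independent_processes ::
    "'a measure \<Rightarrow> (nat \<Rightarrow> real \<Rightarrow> 'a \<Rightarrow> real) \<Rightarrow> nat set \<Rightarrow> bool" where
  "independent_processes M B J \<longleftrightarrow>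
     prob_space.indep_vars M (\<lambda>_. PiM {0..} (\<lambda>_. borel)) (\<lambda>j \<omega>. \<lambda>s\<in>{0..}. B j s \<omega>) J"

text \<open>The supremum is taken in \<open>[0, \<infinity>)\<close>, so that of the empty set is \<open>0\<close>; on \<^typ>\<open>real\<close> the
  value of \<open>Sup {}\<close> is unspecified.\<close>

definition last_zero_before :: "(real \<Rightarrow> real) \<Rightarrow> real \<Rightarrow> real" where
  "last_zero_before f t =
     (let Z = {s. 0 \<le> s \<and> s < t \<and> f s = 0} in if Z = {} then 0 else Sup Z)"

text \<open>From \<open>t\<close>, the paths are used in the order \<open>f n, \<dots>, f 1\<close>: the successive second arguments
  are \<open>t, \<tau>\<^sub>n, \<dots>, \<tau>\<^sub>1\<close>, and the last one is returned.\<close>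

primrec iterated_last_zero :: "(nat \<Rightarrow> real \<Rightarrow> real) \<Rightarrow> nat \<Rightarrow> real \<Rightarrow> real" where
  "iterated_last_zero f 0 t = t"
| "iterated_last_zero f (Suc n) t = iterated_last_zero f n (last_zero_before (f (Suc n)) t)"

text \<open>As paths are only almost surely continuous, this function is in general measurable only
  with respect to the completion of the underlying measure.\<close>

definition iterated_last_zero_time ::
    "(nat \<Rightarrow> real \<Rightarrow> 'a \<Rightarrow> real) \<Rightarrow> nat \<Rightarrow> real \<Rightarrow> 'a \<Rightarrow> real" where
  "iterated_last_zero_time B n t \<omega> = iterated_last_zero (\<lambda>j s. B j s \<omega>) n t"

end

theory Submission imports Defs begin

text \<open>
  For \<open>0 < s < t\<close> the reflection principle says that, on \<open>B\<^sub>s > 0\<close>, the path has a zero in \<open>(s, t)\<close>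
  with probability twice that of \<open>B\<^sub>s > 0 > B\<^sub>t\<close>. Instead of the strong Markov property we use first passage
  times of the path sampled on a finite grid, where reflection only needs that the increment after
  a grid point is symmetric and independent of the past; path continuity makes the overshoot vanish
  as the grid is refined. The Gaussian measure of the wedge \<open>x > 0 > x + y\<close> then gives
  \<open>P(g > s) = 1 - (2/\<pi>) arctan (sqrt (s/(t - s)))\<close> for the last zero \<open>g\<close> before \<open>t\<close>: it is distributed like
  \<open>t (sin \<theta>)\<^sup>2\<close> with \<open>\<theta>\<close> uniform on \<open>[0, \<pi>/2]\<close>, and its moments follow from a reduction formula for powers
  of the sine. As the \<open>m\<close>-th moment is a multiple of \<open>t\<^sup>m\<close>, Fubini's theorem for independent paths
  multiplies these constants along the iteration.
\<close>

section \<open>A measurable version of the last zero\<close>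

text \<open>Having a zero in a time interval is not an event of the product sigma-algebra, and the
  random starting times of the iteration force measurability jointly in path and time. All integrals
  are therefore computed for a version built from rational times and carried over to the true last
  zero on the completed space. The grid argument gives two inequalities instead of an identity: a
  grid sees a zero only as a value below some \<epsilon> > 0, and the first grid passage below 0
  overshoots. The limits of the two bounds involve B_t \<le> 0 and B_t < 0, and agree because B_t
  has no atom at 0. The wedge has Gaussian mass 1/4 - arctan(sqrt(s/(t-s)))/(2 pi). Reflection
  doubles it and the two signs of B_s double it again, whence 1 - (2/pi) arctan. The squared sine
  comes from inverting this tail: for \<theta> in [0, pi/2), s = t (sin \<theta>)^2 means \<theta> =
  arctan(sqrt(s/(t-s))).\<close>

text \<open>Path continuity is not a measurable event of the product sigma-algebra, so zeros are detected through
  rational times; the supremum below is then countable and measurable jointly in path and time.\<close>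

definition near_zero :: "(real \<Rightarrow> real) \<Rightarrow> real \<Rightarrow> real \<Rightarrow> bool" where
  "near_zero f a b \<longleftrightarrow> (\<forall>k::nat. \<exists>q\<in>\<rat> \<inter> {a..b}. \<bar>f q\<bar> < 1 / Suc k)"

definition rat_intervals :: "(real \<times> real) set" where
  "rat_intervals = {(a, b). a \<in> \<rat> \<and> b \<in> \<rat> \<and> 0 \<le> a \<and> a < b}"

definition last_zero_rat :: "(real \<Rightarrow> real) \<Rightarrow> real \<Rightarrow> real" where
  "last_zero_rat f t =
     (SUP p\<in>rat_intervals. if snd p < t \<and> near_zero f (fst p) (snd p) then fst p else 0)"

lemma countable_rat_intervals: "countable rat_intervals"
proof (rule countable_subset)
  show "rat_intervals \<subseteq> \<rat> \<times> \<rat>" by (auto simp: rat_intervals_def)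
qed (simp add: countable_rat)

lemma rat_intervals_nonempty: "(0, 1) \<in> rat_intervals"
  by (auto simp: rat_intervals_def)

lemma bdd_above_last_zero_rat:
  "bdd_above ((\<lambda>p. if snd p < t \<and> near_zero f (fst p) (snd p) then fst p else 0) ` rat_intervals)"
  by (rule bdd_aboveI[of _ "max t 0"]) (auto simp: rat_intervals_def)

lemma last_zero_rat_nonneg: "0 \<le> last_zero_rat f t"
  unfolding last_zero_rat_def
  by (rule cSUP_upper2[OF bdd_above_last_zero_rat rat_intervals_nonempty]) auto

lemma last_zero_rat_le: "last_zero_rat f t \<le> max t 0"
  unfolding last_zero_rat_def
proof (rule cSUP_least)
  show "rat_intervals \<noteq> {}" using rat_intervals_nonempty by auto
qed (auto simp: rat_intervals_def)

text \<open>Path-valued random variables are restrictions to \<open>{0..}\<close>; this lemma lets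
  them replace the unrestricted paths.\<close>

lemma last_zero_rat_cong:
  assumes "\<And>s. 0 \<le> s \<Longrightarrow> f s = g s"
  shows "last_zero_rat f t = last_zero_rat g t"
proof -
  have "near_zero f a b = near_zero g a b" if "0 \<le> a" for a b
  proof -
    have "f q = g q" if "q \<in> {a..b}" for q using that assms \<open>0 \<le> a\<close> by simp
    then have "(\<exists>q\<in>\<rat> \<inter> {a..b}. \<bar>f q\<bar> < e) = (\<exists>q\<in>\<rat> \<inter> {a..b}. \<bar>g q\<bar> < e)" for e by auto
    then show ?thesis unfolding near_zero_def by simp
  qed
  then show ?thesis
    unfolding last_zero_rat_def rat_intervals_def
    by (intro arg_cong[where f=Sup] image_cong[OF refl]) (simp add: case_prod_beta)
qed

text \<open>For a fixed rational interval, \<open>near_zero\<close> is a countable combination of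
  conditions on single coordinates, all with nonnegative index. Joint measurability in
  \<open>t\<close> is what allows a random time to be inserted.\<close>

lemma measurable_last_zero_rat [measurable]:
  "(\<lambda>(f, t). last_zero_rat f t) \<in> borel_measurable (PiM {0..} (\<lambda>_. borel) \<Otimes>\<^sub>M borel)"
proof -
  have *: "Measurable.pred (PiM {0..} (\<lambda>_. borel)) (\<lambda>f. near_zero f a b)" if "0 \<le> a" for a b
  proof -
    have "Measurable.pred (PiM {0..} (\<lambda>_. borel)) (\<lambda>f. \<bar>f q\<bar> < 1 / real (Suc k))"
      if "q \<in> \<rat> \<inter> {a..b}" for q k
    proof -
      have [measurable]: "(\<lambda>f. f q) \<in> borel_measurable (PiM {0..} (\<lambda>_. borel :: real measure))"
        using that \<open>0 \<le> a\<close> by (intro measurable_component_singleton) auto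
      show ?thesis by measurable
    qed
    then have "{f \<in> space (PiM {0..} (\<lambda>_. borel)). \<bar>f q\<bar> < 1 / real (Suc k)} \<in> sets (PiM {0..} (\<lambda>_. borel))"
      if "q \<in> \<rat> \<inter> {a..b}" for q k
      using that by (simp add: pred_def)
    then have "(\<Union>q\<in>\<rat> \<inter> {a..b}. {f \<in> space (PiM {0..} (\<lambda>_. borel)). \<bar>f q\<bar> < 1 / real (Suc k)})
        \<in> sets (PiM {0..} (\<lambda>_. borel))" for k
      by (intro sets.countable_UN'') (auto simp: countable_rat)
    moreover have "(\<Union>q\<in>\<rat> \<inter> {a..b}. {f \<in> space (PiM {0..} (\<lambda>_. borel)). \<bar>f q\<bar> < 1 / real (Suc k)})
        = {f \<in> space (PiM {0..} (\<lambda>_. borel)). \<exists>q\<in>\<rat> \<inter> {a..b}. \<bar>f q\<bar> < 1 / real (Suc k)}" for k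
      by blast
    ultimately show ?thesis
      unfolding near_zero_def by (intro pred_intros_countable) (simp add: pred_def)
  qed
  show ?thesis
    unfolding last_zero_rat_def case_prod_beta
  proof (rule borel_measurable_cSUP[OF countable_rat_intervals])
    fix p assume "p \<in> rat_intervals"
    then have [measurable]: "Measurable.pred (PiM {0..} (\<lambda>_. borel)) (\<lambda>f. near_zero f (fst p) (snd p))"
      by (intro *) (auto simp: rat_intervals_def)
    show "(\<lambda>x. if snd p < snd x \<and> near_zero (fst x) (fst p) (snd p) then fst p else 0)
        \<in> borel_measurable (Pi\<^sub>M {0..} (\<lambda>_. borel) \<Otimes>\<^sub>M borel)"
      by measurable
  qed (rule bdd_above_last_zero_rat)
qed

section \<open>Agreement with the last zero on continuous paths\<close>

lemma near_zeroD:
  assumes "continuous_on {0..} f" "0 \<le> a" "a < b" "near_zero f a b"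
  shows "\<exists>z\<in>{a..b}. f z = 0"
proof -
  \<comment> \<open>By compactness the minimum of the absolute value is attained; being below every
    \<open>1 / Suc k\<close>, it is 0.\<close>
  have "continuous_on {a..b} (\<lambda>x. \<bar>f x\<bar>)"
    using assms by (intro continuous_intros continuous_on_subset[OF assms(1)]) auto
  then obtain z where z: "z \<in> {a..b}" "\<And>y. y \<in> {a..b} \<Longrightarrow> \<bar>f z\<bar> \<le> \<bar>f y\<bar>"
    using continuous_attains_inf[of "{a..b}" "\<lambda>x. \<bar>f x\<bar>"] \<open>a < b\<close> by auto
  have "\<bar>f z\<bar> < 1 / Suc k" for k :: nat
    using assms(4) z(2) unfolding near_zero_def by (meson IntE order_le_less_trans)
  then have "f z = 0"
    by (metis nat_approx_posE not_less_iff_gr_or_eq zero_less_abs_iff)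
  with z show ?thesis by blast
qed

text \<open>The zero lies strictly inside the interval, so there is room for rationals just to its
  right, where continuity keeps the values small.\<close>

lemma near_zeroI:
  assumes "continuous_on {0..} f" "0 \<le> a" "a < z" "z < b" "f z = 0"
  shows "near_zero f a b"
  unfolding near_zero_def
proof
  fix k :: nat
  have "isCont f z"
    using assms by (intro continuous_on_interior[OF assms(1)]) auto
  then have "\<exists>d>0. \<forall>y. dist y z < d \<longrightarrow> dist (f y) (f z) < 1 / real (Suc k)"
    unfolding continuous_at_eps_delta by simp
  then obtain d where d: "d > 0" "\<And>y. dist y z < d \<Longrightarrow> dist (f y) (f z) < 1 / real (Suc k)"
    by blast
  obtain q where q: "q \<in> \<rat>" "z < q" "q < min b (z + d)"
    using Rats_dense_in_real[of z "min b (z + d)"] assms d by auto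
  then have "\<bar>f q\<bar> < 1 / real (Suc k)"
    using d(2)[of q] assms by (simp add: dist_real_def)
  with q assms show "\<exists>q\<in>\<rat> \<inter> {a..b}. \<bar>f q\<bar> < 1 / real (Suc k)"
    by (intro bexI[of _ q]) auto
qed

text \<open>An interval accepted by \<open>near_zero\<close> contains a true zero to the right of
  its left endpoint, so left endpoints never exceed the supremum of the zeros; conversely a zero is
  approached from below by left endpoints of rational intervals around it. The condition
  \<open>f 0 = 0\<close> makes the default value 0 an actual zero when \<open>t > 0\<close>.\<close>

lemma last_zero_rat_eq:
  assumes cont: "continuous_on {0..} f" and "f 0 = 0"
  shows "last_zero_rat f t = last_zero_before f t"
proof (cases "t > 0")
  case False
  then have "{s. 0 \<le> s \<and> s < t \<and> f s = 0} = {}" by auto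
  then have "last_zero_before f t = 0" unfolding last_zero_before_def by simp
  with False last_zero_rat_nonneg[of f t] last_zero_rat_le[of f t] show ?thesis by simp
next
  case True
  define Z where "Z = {s. 0 \<le> s \<and> s < t \<and> f s = 0}"
  have Z0: "0 \<in> Z" using True assms by (simp add: Z_def)
  have bdd: "bdd_above Z" by (rule bdd_aboveI[of _ t]) (auto simp: Z_def)
  have eq: "last_zero_before f t = Sup Z"
    using Z0 unfolding last_zero_before_def Z_def[symmetric] by auto
  show ?thesis unfolding eq
  proof (rule antisym)
    show "last_zero_rat f t \<le> Sup Z"
      unfolding last_zero_rat_def
    proof (rule cSUP_least)
      show "rat_intervals \<noteq> {}" using rat_intervals_nonempty by auto
      fix p assume p: "p \<in> rat_intervals"
      show "(if snd p < t \<and> near_zero f (fst p) (snd p) then fst p else 0) \<le> Sup Z"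
      proof (cases "snd p < t \<and> near_zero f (fst p) (snd p)")
        case True
        then obtain z where "z \<in> {fst p..snd p}" "f z = 0"
          using near_zeroD[OF cont, of "fst p" "snd p"] p by (auto simp: rat_intervals_def)
        then have "z \<in> Z" "fst p \<le> z" using p True by (auto simp: Z_def rat_intervals_def)
        then have "fst p \<le> Sup Z" using cSup_upper[OF _ bdd, of z] by linarith
        then show ?thesis unfolding if_P[OF True] .
      next
        case False
        show ?thesis unfolding if_not_P[OF False] by (rule cSup_upper[OF Z0 bdd])
      qed
    qed
    show "Sup Z \<le> last_zero_rat f t"
    proof (rule cSup_least)
      fix z assume z: "z \<in> Z"
      show "z \<le> last_zero_rat f t"
      \<comment> \<open>The left endpoint must be strictly smaller than \<open>z\<close>, so only
        numbers \<open>y\<close> below \<open>z\<close> are reached, which suffices for the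
        supremum.\<close>
      proof (rule dense_le)
        fix y assume "y < z"
        show "y \<le> last_zero_rat f t"
        proof (cases "y < 0")
          case True
          then show ?thesis using last_zero_rat_nonneg[of f t] by simp
        next
          case False
          obtain a where a: "a \<in> \<rat>" "y < a" "a < z" using Rats_dense_in_real \<open>y < z\<close> by auto
          obtain b where b: "b \<in> \<rat>" "z < b" "b < t" using Rats_dense_in_real[of z t] z by (auto simp: Z_def)
          have "near_zero f a b" using near_zeroI[OF cont, of a z b] a b z False by (auto simp: Z_def)
          moreover have "(a, b) \<in> rat_intervals" using a b False by (auto simp: rat_intervals_def)
          ultimately have "a \<le> last_zero_rat f t"
            unfolding last_zero_rat_def using a b
            by (intro cSUP_upper2[OF bdd_above_last_zero_rat, of "(a, b)"]) auto
          then show ?thesis using a by simp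
        qed
      qed
    qed (use Z0 in auto)
  qed
qed

lemma last_zero_before_nonneg: "0 \<le> last_zero_before f t"
proof -
  let ?Z = "{s. 0 \<le> s \<and> s < t \<and> f s = 0}"
  have "0 \<le> Sup ?Z" if ne: "?Z \<noteq> {}"
  proof -
    obtain z where z: "z \<in> ?Z" using ne by blast
    have "bdd_above ?Z" by (rule bdd_aboveI[of _ t]) auto
    from cSup_upper[OF z this] z show ?thesis by simp
  qed
  then show ?thesis unfolding last_zero_before_def Let_def by auto
qed

text \<open>This turns tails of the law of the last zero into events about zeros in an open
  interval. It holds for every function: if there are no zeros, the default 0 is not above
  \<open>s\<close>, so both sides are false.\<close>

lemma less_last_zero_before_iff:
  assumes "0 \<le> s"
  shows "s < last_zero_before f t \<longleftrightarrow> (\<exists>z. s < z \<and> z < t \<and> f z = 0)"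
proof -
  define Z where "Z = {s. 0 \<le> s \<and> s < t \<and> f s = 0}"
  have bdd: "bdd_above Z" by (rule bdd_aboveI[of _ t]) (auto simp: Z_def)
  show ?thesis
  proof (cases "Z = {}")
    case True
    then show ?thesis using assms unfolding last_zero_before_def Let_def Z_def[symmetric]
      by (auto simp: Z_def)
  next
    case False
    have "s < Sup Z \<longleftrightarrow> (\<exists>z\<in>Z. s < z)" by (rule less_cSup_iff[OF False bdd])
    moreover have "(\<exists>z\<in>Z. s < z) \<longleftrightarrow> (\<exists>z. s < z \<and> z < t \<and> f z = 0)"
    proof
      assume "\<exists>z. s < z \<and> z < t \<and> f z = 0"
      then obtain z where "s < z" "z < t" "f z = 0" by blast
      then show "\<exists>z\<in>Z. s < z" using assms by (intro bexI[of _ z]) (auto simp: Z_def)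
    qed (auto simp: Z_def)
    ultimately show ?thesis using False unfolding last_zero_before_def Let_def Z_def[symmetric]
      by simp
  qed
qed

section \<open>Reflection on finite grids\<close>

context prob_space
begin

text \<open>Dominated convergence for indicators. The pointwise form suits the grid events, which
  need not be monotone in the mesh.\<close>

lemma prob_LIMSEQ_AE:
  assumes [measurable]: "\<And>n. A n \<in> events" "B \<in> events"
    and ev: "AE \<omega> in M. eventually (\<lambda>n. \<omega> \<in> A n \<longleftrightarrow> \<omega> \<in> B) sequentially"
  shows "(\<lambda>n. prob (A n)) \<longlonglongrightarrow> prob B"
proof -
  have "(\<lambda>n. \<integral>\<omega>. indicator (A n) \<omega> \<partial>M) \<longlonglongrightarrow> (\<integral>\<omega>. indicator B \<omega> \<partial>M :: real)"
  proof (rule integral_dominated_convergence[where w="\<lambda>_. 1"])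
    show "AE \<omega> in M. (\<lambda>n. indicator (A n) \<omega> :: real) \<longlonglongrightarrow> indicator B \<omega>"
      using ev
    proof eventually_elim
      case (elim \<omega>)
      then show ?case
        by (intro tendsto_eventually) (auto elim!: eventually_mono simp: indicator_def)
    qed
  qed (auto simp: indicator_def)
  then show ?thesis by simp
qed

text \<open>\<open>Y\<close> and \<open>- Y\<close> have the same density, and a density gives no
  mass to a point. Both the strict and the non-strict half are needed, one for each direction of the
  reflection bound.\<close>

lemma centered_normal_signs:
  assumes Y: "distributed M lborel Y (normal_density 0 \<sigma>)" and "0 < \<sigma>"
  shows "prob {\<omega>\<in>space M. Y \<omega> = 0} = 0"
    and "prob {\<omega>\<in>space M. Y \<omega> < 0} = 1 / 2"
    and "prob {\<omega>\<in>space M. Y \<omega> \<le> 0} = 1 / 2"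
proof -
  have [measurable]: "Y \<in> borel_measurable M" using distributed_measurable[OF Y] by simp
  have "emeasure M (Y -` {0} \<inter> space M) = (\<integral>\<^sup>+x. normal_density 0 \<sigma> x * indicator {0} x \<partial>lborel)"
    using distributed_emeasure[OF Y, of "{0}"] by simp
  also have "\<dots> = (\<integral>\<^sup>+x. 0 \<partial>(lborel :: real measure))"
    by (intro nn_integral_cong_AE) (use AE_lborel_singleton[of 0] in \<open>auto elim: eventually_mono\<close>)
  also have "Y -` {0} \<inter> space M = {\<omega>\<in>space M. Y \<omega> = 0}" by auto
  finally show eq0: "prob {\<omega>\<in>space M. Y \<omega> = 0} = 0" by (simp add: measure_def)
  have "distributed M lborel (\<lambda>x. 0 + (-1) * Y x) (normal_density (0 + (-1) * 0) (\<bar>-1\<bar> * \<sigma>))"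
    using Y \<open>0 < \<sigma>\<close> by (intro normal_density_affine) auto
  then have Y': "distributed M lborel (\<lambda>x. - Y x) (normal_density 0 \<sigma>)" by simp
  have "emeasure M (Y -` {..<0} \<inter> space M) = emeasure M ((\<lambda>x. - Y x) -` {..<0} \<inter> space M)"
    by (simp only: distributed_emeasure[OF Y] distributed_emeasure[OF Y'] sets_lborel lessThan_borel)
  moreover have "Y -` {..<0} \<inter> space M = {\<omega>\<in>space M. Y \<omega> < 0}"
    "(\<lambda>x. - Y x) -` {..<0} \<inter> space M = {\<omega>\<in>space M. Y \<omega> > 0}" by auto
  ultimately have sym: "prob {\<omega>\<in>space M. Y \<omega> < 0} = prob {\<omega>\<in>space M. Y \<omega> > 0}"
    by (simp add: measure_def)
  have le: "prob {\<omega>\<in>space M. Y \<omega> \<le> 0} = prob {\<omega>\<in>space M. Y \<omega> < 0} + prob {\<omega>\<in>space M. Y \<omega> = 0}"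
    by (subst finite_measure_Union[symmetric]) (auto intro!: arg_cong[where f=prob])
  have "1 = prob {\<omega>\<in>space M. Y \<omega> \<le> 0} + prob {\<omega>\<in>space M. Y \<omega> > 0}"
    by (subst finite_measure_Union[symmetric])
       (auto simp: prob_space[symmetric] intro!: arg_cong[where f=prob])
  with le eq0 sym show "prob {\<omega>\<in>space M. Y \<omega> < 0} = 1 / 2" "prob {\<omega>\<in>space M. Y \<omega> \<le> 0} = 1 / 2"
    by simp_all
qed

lemma brownian_measurable:
  "standard_brownian_motion M X \<Longrightarrow> 0 \<le> s \<Longrightarrow> X s \<in> borel_measurable M"
  by (simp add: standard_brownian_motion_def)

lemma brownian_increment:
  "standard_brownian_motion M X \<Longrightarrow> 0 \<le> s \<Longrightarrow> s < t \<Longrightarrow>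
     distributed M lborel (\<lambda>\<omega>. X t \<omega> - X s \<omega>) (normal_density 0 (sqrt (t - s)))"
  by (simp add: standard_brownian_motion_def)

text \<open>Positions relative to \<open>X 0\<close> are partial sums of increments, hence a
  measurable function \<open>h\<close> of the first \<open>k\<close> increments; the last increment
  is independent of these.\<close>

lemma brownian_past_future:
  assumes X: "standard_brownian_motion M X"
    and u: "u 0 = 0" "\<And>i. i < k \<Longrightarrow> u i < u (Suc i)" "u k < v"
    and P[measurable]: "Measurable.pred (PiM {..k} (\<lambda>_. borel)) P" and C[measurable]: "C \<in> sets borel"
  shows "prob {\<omega>\<in>space M. P (\<lambda>i\<in>{..k}. X (u i) \<omega> - X 0 \<omega>) \<and> X v \<omega> - X (u k) \<omega> \<in> C}
       = prob {\<omega>\<in>space M. P (\<lambda>i\<in>{..k}. X (u i) \<omega> - X 0 \<omega>)} * prob {\<omega>\<in>space M. X v \<omega> - X (u k) \<omega> \<in> C}"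
proof -
  \<comment> \<open>\<open>w\<close> appends \<open>v\<close> to the grid, so that the increment
    with index \<open>k\<close> is the one from \<open>u k\<close> to \<open>v\<close>.\<close>
  define w where "w i = (if i \<le> k then u i else v)" for i
  define D where "D i \<omega> = X (w (Suc i)) \<omega> - X (w i) \<omega>" for i \<omega>
  define h where "h d = (\<lambda>i\<in>{..k}. \<Sum>j<i. d j :: real)" for d
  let ?P1 = "PiM {..<k} (\<lambda>_. borel :: real measure)" and ?P2 = "PiM {k} (\<lambda>_. borel :: real measure)"
  have "\<forall>i<Suc k. w i < w (Suc i)" using u by (auto simp: w_def less_Suc_eq)
  moreover have "0 \<le> w 0" using u by (simp add: w_def)
  ultimately have "indep_vars (\<lambda>_. borel) D {..<Suc k}"
    using X unfolding standard_brownian_motion_def D_def by blast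
  then have ind: "indep_var ?P1 (\<lambda>\<omega>. \<lambda>i\<in>{..<k}. D i \<omega>) ?P2 (\<lambda>\<omega>. \<lambda>i\<in>{k}. D i \<omega>)"
    by (rule indep_var_restrict) auto
  have h[measurable]: "h \<in> measurable ?P1 (PiM {..k} (\<lambda>_. borel))"
    unfolding h_def by (intro measurable_restrict borel_measurable_sum measurable_component_singleton) auto
  have tel: "h (\<lambda>i\<in>{..<k}. D i \<omega>) = (\<lambda>i\<in>{..k}. X (u i) \<omega> - X 0 \<omega>)" for \<omega>
  proof
    fix i
    show "h (\<lambda>i\<in>{..<k}. D i \<omega>) i = (\<lambda>i\<in>{..k}. X (u i) \<omega> - X 0 \<omega>) i"
    proof (cases "i \<le> k")
      case True
      have "(\<Sum>j<i. D j \<omega>) = X (w i) \<omega> - X (w 0) \<omega>"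
        unfolding D_def by (rule sum_lessThan_telescope)
      moreover have "(\<Sum>j<i. (\<lambda>i\<in>{..<k}. D i \<omega>) j) = (\<Sum>j<i. D j \<omega>)"
        using True by (intro sum.cong) auto
      ultimately show ?thesis using True u by (simp add: h_def w_def)
    qed (simp add: h_def)
  qed
  have last: "D k \<omega> = X v \<omega> - X (u k) \<omega>" for \<omega> by (simp add: D_def w_def)
  define Q where "Q = {d\<in>space ?P1. P (h d)}"
  define R where "R = {d\<in>space ?P2. d k \<in> C}"
  have Q: "Q \<in> sets ?P1" unfolding Q_def by measurable
  have [measurable]: "(\<lambda>d. d k) \<in> borel_measurable ?P2" by (intro measurable_component_singleton) auto
  have R: "R \<in> sets ?P2" unfolding R_def by measurable
  have spQ: "(\<lambda>i\<in>{..<k}. D i \<omega>) \<in> Q \<longleftrightarrow> P (\<lambda>i\<in>{..k}. X (u i) \<omega> - X 0 \<omega>)" for \<omega>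
    unfolding Q_def by (auto simp: space_PiM tel)
  have spR: "(\<lambda>i\<in>{k}. D i \<omega>) \<in> R \<longleftrightarrow> X v \<omega> - X (u k) \<omega> \<in> C" for \<omega>
    unfolding R_def by (auto simp: space_PiM last)
  from indep_varD[OF ind Q R] show ?thesis
    by (simp add: vimage_def Int_def spQ spR conj_ac)
qed

text \<open>Subtracting \<open>X 0\<close>, which vanishes only almost surely, makes
  \<open>W\<close> an exact function of the increments. The event \<open>A a k\<close> says that
  \<open>k\<close> is the first index from 1 on with value at most \<open>a\<close>. The sign
  condition is imposed at index 1, which will be time \<open>s\<close>; index 0 is time 0. The level
  is a parameter because the upper bound uses a positive level and the lower bound uses 0.\<close>

context
  fixes X :: "real \<Rightarrow> 'a \<Rightarrow> real" and u :: "nat \<Rightarrow> real" and n :: nat and W :: "nat \<Rightarrow> 'a \<Rightarrow> real"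
    and A :: "real \<Rightarrow> nat \<Rightarrow> 'a set"
  assumes X: "standard_brownian_motion M X"
    and u: "u 0 = 0" "\<And>i. i \<le> n \<Longrightarrow> u i < u (Suc i)"
  defines "W \<equiv> \<lambda>i \<omega>. X (u i) \<omega> - X 0 \<omega>"
    and "A \<equiv> \<lambda>a k. {\<omega>\<in>space M. 0 < W 1 \<omega> \<and> (\<forall>i\<in>{1..<k}. a < W i \<omega>) \<and> W k \<omega> \<le> a}"
begin

lemma grid_nonneg: "i \<le> Suc n \<Longrightarrow> 0 \<le> u i"
proof (induction i)
  case (Suc i)
  then show ?case using u(2)[of i] by simp
qed (simp add: u)

lemma grid_less: "i < j \<Longrightarrow> j \<le> Suc n \<Longrightarrow> u i < u j"
proof (induction j)
  case (Suc j)
  then show ?case using u(2)[of j] by (cases "i = j") auto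
qed simp

lemma measurable_grid: "i \<le> Suc n \<Longrightarrow> W i \<in> borel_measurable M"
  unfolding W_def using brownian_measurable[OF X] grid_nonneg by (intro borel_measurable_diff) auto

lemma first_passage_events: "k \<in> {1..Suc n} \<Longrightarrow> A a k \<in> events"
proof -
  assume k: "k \<in> {1..Suc n}"
  have [measurable]: "W 1 \<in> borel_measurable M" "W k \<in> borel_measurable M"
    "\<And>i. i \<in> {1..<k} \<Longrightarrow> W i \<in> borel_measurable M"
    using k by (auto intro!: measurable_grid)
  show ?thesis unfolding A_def by measurable
qed

lemma first_passage_indep:
  assumes k: "k \<in> {1..n}" and C: "C \<in> sets borel"
  shows "prob {\<omega>\<in>A a k. X (u (Suc n)) \<omega> - X (u k) \<omega> \<in> C}
       = prob (A a k) * prob {\<omega>\<in>space M. X (u (Suc n)) \<omega> - X (u k) \<omega> \<in> C}"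
proof -
  define P where "P f \<longleftrightarrow> 0 < f 1 \<and> (\<forall>i\<in>{1..<k}. a < f i) \<and> f k \<le> a" for f :: "nat \<Rightarrow> real"
  have c: "(\<lambda>f. f i) \<in> borel_measurable (PiM {..k} (\<lambda>_. borel :: real measure))" if "i \<le> k" for i
    using that by (intro measurable_component_singleton) auto
  have [measurable]: "(\<lambda>f. f 1) \<in> borel_measurable (PiM {..k} (\<lambda>_. borel :: real measure))"
    "(\<lambda>f. f k) \<in> borel_measurable (PiM {..k} (\<lambda>_. borel :: real measure))"
    "\<And>i. i \<in> {1..<k} \<Longrightarrow> (\<lambda>f. f i) \<in> borel_measurable (PiM {..k} (\<lambda>_. borel :: real measure))"
    using k by (auto intro!: c)
  have P: "Measurable.pred (PiM {..k} (\<lambda>_. borel)) P"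
    unfolding P_def by measurable
  have A: "A a k = {\<omega>\<in>space M. P (\<lambda>i\<in>{..k}. X (u i) \<omega> - X 0 \<omega>)}"
    unfolding A_def P_def W_def using k by auto
  show ?thesis
    unfolding A mem_Collect_eq conj_assoc
    by (rule brownian_past_future[where u=u and X=X and k=k, OF X u(1) _ _ P C]) (use u(2) k grid_less in auto)
qed

text \<open>This is the discrete substitute for the strong Markov property: \<open>A a k\<close> is
  determined by the path up to index \<open>k\<close>, and the increment from there to the last grid
  point is independent and symmetric.\<close>

lemma first_passage_half:
  assumes k: "k \<in> {1..n}"
  shows "prob {\<omega>\<in>A a k. W (Suc n) \<omega> \<le> W k \<omega>} = prob (A a k) / 2"
    and "prob {\<omega>\<in>A a k. W (Suc n) \<omega> < W k \<omega>} = prob (A a k) / 2"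
proof -
  have D: "distributed M lborel (\<lambda>\<omega>. X (u (Suc n)) \<omega> - X (u k) \<omega>) (normal_density 0 (sqrt (u (Suc n) - u k)))"
    using k by (intro brownian_increment[OF X] grid_nonneg grid_less) auto
  have pos: "0 < sqrt (u (Suc n) - u k)" using grid_less[of k "Suc n"] k by simp
  have "prob {\<omega>\<in>space M. X (u (Suc n)) \<omega> - X (u k) \<omega> \<in> {..0}} = 1 / 2"
    "prob {\<omega>\<in>space M. X (u (Suc n)) \<omega> - X (u k) \<omega> \<in> {..<0}} = 1 / 2"
    using centered_normal_signs(2,3)[OF D pos] by simp_all
  with first_passage_indep[OF k, of "{..0}" a] first_passage_indep[OF k, of "{..<0}" a]
  show "prob {\<omega>\<in>A a k. W (Suc n) \<omega> \<le> W k \<omega>} = prob (A a k) / 2"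
    "prob {\<omega>\<in>A a k. W (Suc n) \<omega> < W k \<omega>} = prob (A a k) / 2"
    by (simp_all add: W_def)
qed

lemma first_passage_disjoint: "disjoint_family_on (A a) {1..Suc n}"
proof -
  have "A a i \<inter> A a j = {}" if "i < j" "i \<in> {1..Suc n}" for i j
  proof (rule ccontr)
    assume "A a i \<inter> A a j \<noteq> {}"
    then obtain \<omega> where "\<omega> \<in> A a i" "\<omega> \<in> A a j" by blast
    then have "W i \<omega> \<le> a" "\<forall>i\<in>{1..<j}. a < W i \<omega>" by (simp_all add: A_def)
    with that show False by (metis atLeastAtMost_iff atLeastLessThan_iff not_le)
  qed
  then show ?thesis
    unfolding disjoint_family_on_def by (metis Int_commute linorder_neqE_nat)
qed

lemma first_passage_Union:
  "(\<Union>k\<in>{1..Suc n}. A a k) = {\<omega>\<in>space M. 0 < W 1 \<omega> \<and> (\<exists>k\<in>{1..Suc n}. W k \<omega> \<le> a)}" (is "_ = ?R")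
proof (intro equalityI subsetI)
  fix \<omega> assume \<omega>: "\<omega> \<in> ?R"
  define k where "k = (LEAST k. k \<in> {1..Suc n} \<and> W k \<omega> \<le> a)"
  have "\<exists>k. k \<in> {1..Suc n} \<and> W k \<omega> \<le> a" using \<omega> by blast
  then have "k \<in> {1..Suc n} \<and> W k \<omega> \<le> a" unfolding k_def by (rule LeastI_ex)
  then have k: "k \<in> {1..Suc n}" "W k \<omega> \<le> a" by simp_all
  have "a < W i \<omega>" if "i \<in> {1..<k}" for i
    using not_less_Least[of i "\<lambda>k. k \<in> {1..Suc n} \<and> W k \<omega> \<le> a"] that k unfolding k_def[symmetric]
    by (auto simp: not_le)
  with k \<omega> show "\<omega> \<in> (\<Union>k\<in>{1..Suc n}. A a k)" unfolding A_def by blast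
qed (auto simp: A_def)

lemma prob_first_passage_sum:
  "prob {\<omega>\<in>space M. 0 < W 1 \<omega> \<and> (\<exists>k\<in>{1..Suc n}. W k \<omega> \<le> a)} = (\<Sum>k\<in>{1..Suc n}. prob (A a k))"
  unfolding first_passage_Union[symmetric]
  by (rule finite_measure_finite_Union) (use first_passage_events first_passage_disjoint in auto)

text \<open>After first passage at \<open>k\<close>, the path ends at or below \<open>W k\<close>,
  hence at or below \<open>a\<close>, with conditional probability at least 1/2. In this direction
  the overshoot only helps.\<close>

lemma grid_reflection_upper:
  "prob {\<omega>\<in>space M. 0 < W 1 \<omega> \<and> (\<exists>k\<in>{1..Suc n}. W k \<omega> \<le> a)}
     \<le> 2 * prob {\<omega>\<in>space M. 0 < W 1 \<omega> \<and> W (Suc n) \<omega> \<le> a}"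
proof -
  have [measurable]: "\<And>i. i \<in> {1..Suc n} \<Longrightarrow> W i \<in> borel_measurable M" "W (Suc n) \<in> borel_measurable M"
    "W 1 \<in> borel_measurable M"
    by (auto intro: measurable_grid)
  have [measurable]: "\<And>k. k \<in> {1..Suc n} \<Longrightarrow> A a k \<in> events" by (rule first_passage_events)
  have "prob (A a k) \<le> 2 * prob {\<omega>\<in>A a k. W (Suc n) \<omega> \<le> W k \<omega>}" if k: "k \<in> {1..Suc n}" for k
  \<comment> \<open>At the last grid index the non-strict comparison is with itself and holds on all
    of \<open>A a k\<close>.\<close>
  proof (cases "k = Suc n")
    case True
    then show ?thesis by simp
  next
    case False
    then show ?thesis using first_passage_half(1)[of k a] k by simp
  qed
  then have "(\<Sum>k\<in>{1..Suc n}. prob (A a k)) \<le> (\<Sum>k\<in>{1..Suc n}. 2 * prob {\<omega>\<in>A a k. W (Suc n) \<omega> \<le> W k \<omega>})"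
    by (rule sum_mono)
  also have "\<dots> = 2 * (\<Sum>k\<in>{1..Suc n}. prob {\<omega>\<in>A a k. W (Suc n) \<omega> \<le> W k \<omega>})"
    by (rule sum_distrib_left[symmetric])
  also have "(\<Sum>k\<in>{1..Suc n}. prob {\<omega>\<in>A a k. W (Suc n) \<omega> \<le> W k \<omega>})
      = prob (\<Union>k\<in>{1..Suc n}. {\<omega>\<in>A a k. W (Suc n) \<omega> \<le> W k \<omega>})"
  proof (rule finite_measure_finite_Union[symmetric])
    show "(\<lambda>k. {\<omega>\<in>A a k. W (Suc n) \<omega> \<le> W k \<omega>}) ` {1..Suc n} \<subseteq> events"
    proof safe
      fix k assume "k \<in> {1..Suc n}"
      then have [measurable]: "A a k \<in> events" "W k \<in> borel_measurable M" by auto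
      show "{\<omega>\<in>A a k. W (Suc n) \<omega> \<le> W k \<omega>} \<in> events" by measurable
    qed
    show "disjoint_family_on (\<lambda>k. {\<omega>\<in>A a k. W (Suc n) \<omega> \<le> W k \<omega>}) {1..Suc n}"
      using first_passage_disjoint[of a] unfolding disjoint_family_on_def by blast
  qed simp
  also have "\<dots> \<le> prob {\<omega>\<in>space M. 0 < W 1 \<omega> \<and> W (Suc n) \<omega> \<le> a}"
    by (rule finite_measure_mono) (auto simp: A_def)
  finally show ?thesis unfolding prob_first_passage_sum by simp
qed

text \<open>A path ending below -\<epsilon> has passed level 0 at some first index \<open>k\<close>.
  Either it ends strictly below \<open>W k\<close>, which costs a factor 1/2, or \<open>W k\<close>
  itself is below -\<epsilon>, so that the step into \<open>k\<close> jumps by more than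
  \<epsilon>.\<close>

lemma grid_reflection_lower:
  assumes "0 < \<epsilon>"
  shows "prob {\<omega>\<in>space M. 0 < W 1 \<omega> \<and> W (Suc n) \<omega> < - \<epsilon>}
     \<le> prob {\<omega>\<in>space M. 0 < W 1 \<omega> \<and> (\<exists>k\<in>{1..Suc n}. W k \<omega> \<le> 0)} / 2
       + prob {\<omega>\<in>space M. \<exists>k\<in>{1..n}. \<epsilon> \<le> \<bar>W (Suc k) \<omega> - W k \<omega>\<bar>}" (is "prob ?L \<le> _ + prob ?H")
proof -
  have [measurable]: "\<And>i. i \<in> {1..Suc n} \<Longrightarrow> W i \<in> borel_measurable M" "W (Suc n) \<in> borel_measurable M"
    "W 1 \<in> borel_measurable M"
    by (auto intro: measurable_grid)
  have ev: "{\<omega>\<in>A 0 k. W (Suc n) \<omega> < W k \<omega>} \<in> events" if "k \<in> {1..Suc n}" for k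
  proof -
    have [measurable]: "A 0 k \<in> events" "W k \<in> borel_measurable M"
      using that first_passage_events by auto
    show ?thesis by measurable
  qed
  have H: "?H \<in> events"
  proof -
    have "Measurable.pred M (\<lambda>\<omega>. \<epsilon> \<le> \<bar>W (Suc k) \<omega> - W k \<omega>\<bar>)" if "k \<in> {1..n}" for k
    proof -
      have [measurable]: "W k \<in> borel_measurable M" "W (Suc k) \<in> borel_measurable M"
        using that by (auto intro!: measurable_grid)
      show ?thesis by measurable
    qed
    then have "Measurable.pred M (\<lambda>\<omega>. \<exists>k\<in>{1..n}. \<epsilon> \<le> \<bar>W (Suc k) \<omega> - W k \<omega>\<bar>)"
      by (intro pred_intros_finite) auto
    then show ?thesis by (simp add: pred_def)
  qed
  let ?U = "\<Union>k\<in>{1..Suc n}. {\<omega>\<in>A 0 k. W (Suc n) \<omega> < W k \<omega>}"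
  have U: "?U \<in> events" using ev by (intro sets.finite_UN) auto
  have "?L \<subseteq> ?U \<union> ?H"
  proof
    fix \<omega> assume \<omega>: "\<omega> \<in> ?L"
    then have "\<omega> \<in> (\<Union>k\<in>{1..Suc n}. A 0 k)"
      unfolding first_passage_Union using \<open>0 < \<epsilon>\<close> by force
    then obtain k where k: "k \<in> {1..Suc n}" "\<omega> \<in> A 0 k" by blast
    show "\<omega> \<in> ?U \<union> ?H"
    proof (cases "W (Suc n) \<omega> < W k \<omega>")
      case True
      with k show ?thesis by blast
    next
      case False
      \<comment> \<open>\<open>W 1\<close> is positive while \<open>W k\<close> is not, so
        \<open>k\<close> has a predecessor with index at least 1, whose value is still
        positive.\<close>
      have "k \<noteq> 1" using k by (auto simp: A_def)
      then obtain j where j: "k = Suc j" "j \<in> {1..n}" using k by (cases k) auto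
      have "0 < W j \<omega>" using k j by (auto simp: A_def)
      moreover have "W k \<omega> < - \<epsilon>" using False \<omega> by auto
      ultimately have "\<epsilon> \<le> \<bar>W (Suc j) \<omega> - W j \<omega>\<bar>" using j by simp
      with j \<omega> show ?thesis by blast
    qed
  qed
  then have "prob ?L \<le> prob (?U \<union> ?H)" using U H by (intro finite_measure_mono) auto
  also have "\<dots> \<le> prob ?U + prob ?H" using U H by (rule measure_Un_le)
  also have "prob ?U \<le> (\<Sum>k\<in>{1..Suc n}. prob {\<omega>\<in>A 0 k. W (Suc n) \<omega> < W k \<omega>})"
    using ev by (intro finite_measure_subadditive_finite) auto
  also have "\<dots> \<le> (\<Sum>k\<in>{1..Suc n}. prob (A 0 k) / 2)"
  proof (rule sum_mono)
    fix k assume k: "k \<in> {1..Suc n}"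
    show "prob {\<omega>\<in>A 0 k. W (Suc n) \<omega> < W k \<omega>} \<le> prob (A 0 k) / 2"
    \<comment> \<open>At the last index the strict comparison is with itself, so the event is
      empty.\<close>
    proof (cases "k = Suc n")
      case False
      then show ?thesis using first_passage_half(2)[of k 0] k by simp
    qed simp
  qed
  also have "\<dots> = prob {\<omega>\<in>space M. 0 < W 1 \<omega> \<and> (\<exists>k\<in>{1..Suc n}. W k \<omega> \<le> 0)} / 2"
    unfolding prob_first_passage_sum by (rule sum_divide_distrib[symmetric])
  finally show ?thesis by simp
qed

end

end

section \<open>Refining the grid: from grids to continuous paths\<close>

lemma continuous_grid_increments_small:
  fixes f :: "real \<Rightarrow> real"
  assumes f: "continuous_on {s..t} f" and "s < t" "0 < \<epsilon>"
  shows "\<forall>\<^sub>F n in sequentially. \<forall>x\<in>{s..t}. \<forall>y\<in>{s..t}. \<bar>x - y\<bar> \<le> (t - s) / real (Suc n) \<longrightarrow> \<bar>f x - f y\<bar> < \<epsilon>"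
proof -
  have "uniformly_continuous_on {s..t} f"
    using f by (intro compact_uniformly_continuous) auto
  then obtain d where d: "d > 0" "\<And>x y. x \<in> {s..t} \<Longrightarrow> y \<in> {s..t} \<Longrightarrow> dist x y < d \<Longrightarrow> dist (f x) (f y) < \<epsilon>"
    unfolding uniformly_continuous_on_def using \<open>0 < \<epsilon>\<close> by metis
  have "(\<lambda>n. (t - s) / real (Suc n)) \<longlonglongrightarrow> 0"
    by (rule LIMSEQ_Suc) (rule lim_const_over_n)
  then have "\<forall>\<^sub>F n in sequentially. (t - s) / real (Suc n) < d"
    using d(1) by (rule order_tendstoD)
  then show ?thesis
  proof eventually_elim
    case (elim n)
    then show ?case using d(2) by (auto simp: dist_real_def)
  qed
qed

text \<open>The first step is the long one from 0 to \<open>s\<close>; the remaining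
  \<open>n\<close> steps divide the interval from \<open>s\<close> to \<open>t\<close> evenly, which
  explains the shift by one in the index.\<close>

definition grid :: "real \<Rightarrow> real \<Rightarrow> nat \<Rightarrow> nat \<Rightarrow> real" where
  "grid s t n i = (if i = 0 then 0 else s + (t - s) * (real i - 1) / real n)"

lemma grid_simps:
  assumes "0 < n"
  shows "grid s t n 0 = 0" "grid s t n (Suc 0) = s" "grid s t n (Suc n) = t"
    "0 < i \<Longrightarrow> grid s t n (Suc i) - grid s t n i = (t - s) / real n"
  using assms by (auto simp: grid_def field_simps)

lemma grid_mem:
  assumes "s < t" "i \<in> {1..Suc n}" "0 < n"
  shows "grid s t n i \<in> {s..t}"
proof -
  have "0 \<le> (t - s) * ((real i - 1) / real n)"
    using assms by (intro mult_nonneg_nonneg) auto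
  moreover have "(t - s) * ((real i - 1) / real n) \<le> (t - s) * 1"
    using assms by (intro mult_left_mono) auto
  ultimately show ?thesis using assms by (auto simp: grid_def)
qed

lemma grid_step_less:
  assumes "0 < s" "s < t" "0 < n"
  shows "grid s t n i < grid s t n (Suc i)"
proof (cases "i = 0")
  case False
  then have "0 < grid s t n (Suc i) - grid s t n i"
    using assms by (subst grid_simps(4)) auto
  then show ?thesis by simp
qed (use assms in \<open>auto simp: grid_simps\<close>)

lemma grid_near:
  assumes "s \<le> z" "z < t" "0 < n"
  shows "\<exists>i\<in>{1..Suc n}. \<bar>grid s t n i - z\<bar> \<le> (t - s) / real n"
proof -
  \<comment> \<open>\<open>y\<close> is the position of \<open>z\<close> measured in grid steps from
    \<open>s\<close>; its integer part gives the neighbouring grid point on the left.\<close>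
  define y where "y = (z - s) * real n / (t - s)"
  have y: "0 \<le> y" "y < real n" "z = s + (t - s) * y / real n"
    using assms by (auto simp: y_def field_simps)
  have "real (nat \<lfloor>y\<rfloor>) \<le> y" "y \<le> real (nat \<lfloor>y\<rfloor>) + 1"
    using y(1) by linarith+
  then obtain j :: nat where j: "real j \<le> y" "y \<le> real j + 1" by blast
  then have "Suc j \<in> {1..Suc n}" using y by simp
  moreover have "grid s t n (Suc j) - z = (t - s) / real n * (real j - y)"
    unfolding y(3) grid_def using assms by (simp add: field_simps)
  moreover have "\<bar>(t - s) / real n * (real j - y)\<bar> \<le> (t - s) / real n * 1"
    unfolding abs_mult using j assms by (intro mult_mono) auto
  ultimately have "\<bar>grid s t n (Suc j) - z\<bar> \<le> (t - s) / real n" "Suc j \<in> {1..Suc n}" by simp_all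
  then show ?thesis by blast
qed

text \<open>The event \<open>E\<close> stands for the existence of a zero, which as a set of
  outcomes need not be measurable. Near a zero the path has small values but possibly no nonpositive
  grid value, so the grid bound is applied at a level \<epsilon> > 0 that tends to 0 after the
  mesh.\<close>

lemma (in prob_space) brownian_zero_upper:
  fixes s t :: real
  assumes X: "standard_brownian_motion M X" and st: "0 < s" "s < t"
  defines "V \<equiv> \<lambda>r \<omega>. X r \<omega> - X 0 \<omega>"
  assumes E[measurable]: "E \<in> events" and E_iff: "AE \<omega> in M. \<omega> \<in> E \<longleftrightarrow> (\<exists>z. s < z \<and> z < t \<and> V z \<omega> = 0)"
  shows "prob {\<omega>\<in>E. 0 < V s \<omega>} \<le> 2 * prob {\<omega>\<in>space M. 0 < V s \<omega> \<and> V t \<omega> \<le> 0}"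
proof -
  have V: "V r \<in> borel_measurable M" if "0 \<le> r" for r
    unfolding V_def using brownian_measurable[OF X] that by (intro borel_measurable_diff) auto
  have [measurable]: "V s \<in> borel_measurable M" "V t \<in> borel_measurable M"
    using st by (auto intro!: V)
  have cont: "AE \<omega> in M. continuous_on {s..t} (\<lambda>r. V r \<omega>)"
  proof -
    have "AE \<omega> in M. continuous_on {0..} (\<lambda>r. X r \<omega>)"
      using X by (simp add: standard_brownian_motion_def)
    then show ?thesis
      by eventually_elim (use st in \<open>auto simp: V_def intro!: continuous_intros elim: continuous_on_subset\<close>)
  qed
  have bound: "prob {\<omega>\<in>E. 0 < V s \<omega>} \<le> 2 * prob {\<omega>\<in>space M. 0 < V s \<omega> \<and> V t \<omega> \<le> \<epsilon>}" if "0 < \<epsilon>" for \<epsilon>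
  proof -
    let ?g = "\<lambda>n. grid s t (Suc n)"
    define F where "F n = {\<omega>\<in>space M. 0 < V s \<omega> \<and> (\<exists>k\<in>{1..Suc (Suc n)}. V (?g n k) \<omega> \<le> \<epsilon>)}" for n
    have F[measurable]: "F n \<in> events" for n
    proof -
      have "Measurable.pred M (\<lambda>\<omega>. V (?g n k) \<omega> \<le> \<epsilon>)" if "k \<in> {1..Suc (Suc n)}" for k
      proof -
        have [measurable]: "V (?g n k) \<in> borel_measurable M"
          using grid_mem[of s t k "Suc n"] that st by (intro V) auto
        show ?thesis by measurable
      qed
      then have [measurable]: "Measurable.pred M (\<lambda>\<omega>. \<exists>k\<in>{1..Suc (Suc n)}. V (?g n k) \<omega> \<le> \<epsilon>)"
        by (intro pred_intros_finite) auto
      show ?thesis unfolding F_def by measurable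
    qed
    have "prob (F n) \<le> 2 * prob {\<omega>\<in>space M. 0 < V s \<omega> \<and> V t \<omega> \<le> \<epsilon>}" for n
    proof -
      have "?g n i < ?g n (Suc i)" if "i \<le> Suc n" for i
        using st by (intro grid_step_less) auto
      from grid_reflection_upper[where u="?g n" and n="Suc n" and a=\<epsilon>, OF X grid_simps(1) this] show ?thesis
        unfolding F_def V_def using grid_simps[where n="Suc n" and s=s and t=t] by simp
    qed
    moreover have "prob {\<omega>\<in>{\<omega>\<in>E. 0 < V s \<omega>}. \<omega> \<in> F n} \<le> prob (F n)" for n
      by (intro finite_measure_mono) auto
    ultimately have le: "prob {\<omega>\<in>{\<omega>\<in>E. 0 < V s \<omega>}. \<omega> \<in> F n} \<le> 2 * prob {\<omega>\<in>space M. 0 < V s \<omega> \<and> V t \<omega> \<le> \<epsilon>}" for n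
      by (rule order_trans[rotated])
    \<comment> \<open>The intersection with \<open>E\<close> matters: a path may fall below
      \<epsilon> without a zero, so \<open>F n\<close> alone need not converge to the wanted event.
      On \<open>E\<close>, a sufficiently fine grid has a point close enough to the zero.\<close>
    have "(\<lambda>n. prob {\<omega>\<in>{\<omega>\<in>E. 0 < V s \<omega>}. \<omega> \<in> F n}) \<longlonglongrightarrow> prob {\<omega>\<in>E. 0 < V s \<omega>}"
    proof (rule prob_LIMSEQ_AE)
      show "AE \<omega> in M. \<forall>\<^sub>F n in sequentially. (\<omega> \<in> {\<omega>\<in>{\<omega>\<in>E. 0 < V s \<omega>}. \<omega> \<in> F n}) = (\<omega> \<in> {\<omega>\<in>E. 0 < V s \<omega>})"
        using cont E_iff AE_space
      proof eventually_elim
        case (elim \<omega>)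
        show ?case
        proof (cases "\<omega> \<in> E \<and> 0 < V s \<omega>")
          case True
          then obtain z where z: "s < z" "z < t" "V z \<omega> = 0" using elim by blast
          from continuous_grid_increments_small[OF elim(1) st(2) \<open>0 < \<epsilon>\<close>]
          show ?thesis
          proof eventually_elim
            case (elim n)
            obtain i where i: "i \<in> {1..Suc (Suc n)}" "\<bar>?g n i - z\<bar> \<le> (t - s) / real (Suc n)"
              using grid_near[of s z t "Suc n"] z by auto
            have "?g n i \<in> {s..t}" using grid_mem[of s t i "Suc n"] i st by simp
            moreover have "z \<in> {s..t}" using z by simp
            ultimately have "\<bar>V (?g n i) \<omega> - V z \<omega>\<bar> < \<epsilon>" using elim i(2) by blast
            then have "V (?g n i) \<omega> \<le> \<epsilon>" using z by simp
            with i True \<open>\<omega> \<in> space M\<close> show ?case unfolding F_def by blast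
          qed
        qed auto
      qed
    qed measurable
    then show ?thesis using le by (intro LIMSEQ_le_const2) auto
  qed
  \<comment> \<open>The levels decrease to 0, and the limit of the events keeps the non-strict
    inequality.\<close>
  have "(\<lambda>n. prob {\<omega>\<in>space M. 0 < V s \<omega> \<and> V t \<omega> \<le> 1 / real (Suc n)}) \<longlonglongrightarrow> prob {\<omega>\<in>space M. 0 < V s \<omega> \<and> V t \<omega> \<le> 0}"
  proof (rule prob_LIMSEQ_AE, measurable, intro AE_I2)
    fix \<omega>
    have "\<forall>\<^sub>F n in sequentially. (V t \<omega> \<le> 1 / real (Suc n)) = (V t \<omega> \<le> 0)"
    proof (cases "V t \<omega> \<le> 0")
      case True
      then have "V t \<omega> \<le> 1 / real (Suc n)" for n by (rule order_trans) simp
      with True show ?thesis by simp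
    next
      case False
      then have "\<forall>\<^sub>F n in sequentially. 1 / real (Suc n) < V t \<omega>"
        by (intro order_tendstoD[OF LIMSEQ_Suc[OF lim_const_over_n]]) auto
      then show ?thesis by eventually_elim (use False in auto)
    qed
    then show "\<forall>\<^sub>F n in sequentially. (\<omega> \<in> {\<omega>\<in>space M. 0 < V s \<omega> \<and> V t \<omega> \<le> 1 / real (Suc n)}) = (\<omega> \<in> {\<omega>\<in>space M. 0 < V s \<omega> \<and> V t \<omega> \<le> 0})"
      by eventually_elim auto
  qed
  then have "(\<lambda>n. 2 * prob {\<omega>\<in>space M. 0 < V s \<omega> \<and> V t \<omega> \<le> 1 / real (Suc n)}) \<longlonglongrightarrow> 2 * prob {\<omega>\<in>space M. 0 < V s \<omega> \<and> V t \<omega> \<le> 0}"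
    by (intro tendsto_mult tendsto_const)
  then show ?thesis
    by (rule LIMSEQ_le_const) (intro exI[of _ 0] allI impI bound, simp)
qed

text \<open>A nonpositive grid value after a positive value at \<open>s\<close> forces a zero by the
  intermediate value theorem, so no approximation of \<open>E\<close> is required here. The error
  term is a large grid increment, whose probability tends to 0 by uniform continuity of the
  path.\<close>

lemma (in prob_space) brownian_zero_lower:
  fixes s t :: real
  assumes X: "standard_brownian_motion M X" and st: "0 < s" "s < t"
  defines "V \<equiv> \<lambda>r \<omega>. X r \<omega> - X 0 \<omega>"
  assumes E[measurable]: "E \<in> events" and E_iff: "AE \<omega> in M. \<omega> \<in> E \<longleftrightarrow> (\<exists>z. s < z \<and> z < t \<and> V z \<omega> = 0)"
  shows "2 * prob {\<omega>\<in>space M. 0 < V s \<omega> \<and> V t \<omega> < 0} \<le> prob {\<omega>\<in>E. 0 < V s \<omega>}"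
proof -
  have V: "V r \<in> borel_measurable M" if "0 \<le> r" for r
    unfolding V_def using brownian_measurable[OF X] that by (intro borel_measurable_diff) auto
  have [measurable]: "V s \<in> borel_measurable M" "V t \<in> borel_measurable M"
    using st by (auto intro!: V)
  have cont: "AE \<omega> in M. continuous_on {s..t} (\<lambda>r. V r \<omega>)"
  proof -
    have "AE \<omega> in M. continuous_on {0..} (\<lambda>r. X r \<omega>)"
      using X by (simp add: standard_brownian_motion_def)
    then show ?thesis
      by eventually_elim (use st in \<open>auto simp: V_def intro!: continuous_intros elim: continuous_on_subset\<close>)
  qed
  have "prob {\<omega>\<in>space M. V t \<omega> = 0} = 0"
    unfolding V_def using st by (intro centered_normal_signs(1)[OF brownian_increment[OF X]]) auto
  then have Vt: "AE \<omega> in M. V t \<omega> \<noteq> 0"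
    by (subst (asm) prob_eq_0) (auto simp: AE_conj_iff elim: eventually_mono)
  let ?g = "\<lambda>n. grid s t (Suc n)"
  define F where "F n = {\<omega>\<in>space M. 0 < V s \<omega> \<and> (\<exists>k\<in>{1..Suc (Suc n)}. V (?g n k) \<omega> \<le> 0)}" for n
  have Vg: "V (?g n k) \<in> borel_measurable M" if "k \<in> {1..Suc (Suc n)}" for n k
    using grid_mem[of s t k "Suc n"] that st by (intro V) auto
  have F_le: "prob (F n) \<le> prob {\<omega>\<in>E. 0 < V s \<omega>}" for n
  proof (rule finite_measure_mono_AE)
    show "AE \<omega> in M. \<omega> \<in> F n \<longrightarrow> \<omega> \<in> {\<omega>\<in>E. 0 < V s \<omega>}"
      using cont E_iff Vt
    proof eventually_elim
      case (elim \<omega>)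
      show ?case
      proof
        assume "\<omega> \<in> F n"
        then obtain k where k: "0 < V s \<omega>" "k \<in> {1..Suc (Suc n)}" "V (?g n k) \<omega> \<le> 0"
          unfolding F_def by blast
        have g: "s \<le> ?g n k" "?g n k \<le> t" using grid_mem[of s t k "Suc n"] k st by auto
        have "continuous_on {s..?g n k} (\<lambda>r. V r \<omega>)"
          using g by (intro continuous_on_subset[OF elim(1)]) auto
        then obtain z where z: "s \<le> z" "z \<le> ?g n k" "V z \<omega> = 0"
          using IVT2'[of "\<lambda>r. V r \<omega>" "?g n k" 0 s] k g by auto
        \<comment> \<open>The zero must lie in the open interval: the value at \<open>s\<close> is
          positive, and the value at \<open>t\<close> is almost surely nonzero.\<close>
        have "s \<noteq> z" "z \<noteq> t" using z k elim by auto
        then have "\<exists>z. s < z \<and> z < t \<and> V z \<omega> = 0" using z g by (intro exI[of _ z]) auto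
        with elim k show "\<omega> \<in> {\<omega>\<in>E. 0 < V s \<omega>}" by blast
      qed
    qed
  qed measurable
  have bound: "2 * prob {\<omega>\<in>space M. 0 < V s \<omega> \<and> V t \<omega> < - \<epsilon>} \<le> prob {\<omega>\<in>E. 0 < V s \<omega>}" if "0 < \<epsilon>" for \<epsilon>
  proof -
    define H where "H n = {\<omega>\<in>space M. \<exists>k\<in>{1..Suc n}. \<epsilon> \<le> \<bar>V (?g n (Suc k)) \<omega> - V (?g n k) \<omega>\<bar>}" for n
    have H[measurable]: "H n \<in> events" for n
    proof -
      have "Measurable.pred M (\<lambda>\<omega>. \<epsilon> \<le> \<bar>V (?g n (Suc k)) \<omega> - V (?g n k) \<omega>\<bar>)" if "k \<in> {1..Suc n}" for k
      proof -
        have [measurable]: "V (?g n k) \<in> borel_measurable M" "V (?g n (Suc k)) \<in> borel_measurable M"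
          using that by (auto intro!: Vg)
        show ?thesis by measurable
      qed
      then have [measurable]: "Measurable.pred M (\<lambda>\<omega>. \<exists>k\<in>{1..Suc n}. \<epsilon> \<le> \<bar>V (?g n (Suc k)) \<omega> - V (?g n k) \<omega>\<bar>)"
        by (intro pred_intros_finite) auto
      show ?thesis unfolding H_def by measurable
    qed
    have "prob {\<omega>\<in>space M. 0 < V s \<omega> \<and> V t \<omega> < - \<epsilon>} \<le> prob (F n) / 2 + prob (H n)" for n
    proof -
      have "?g n i < ?g n (Suc i)" if "i \<le> Suc n" for i
        using st by (intro grid_step_less) auto
      from grid_reflection_lower[where u="?g n" and n="Suc n", OF X grid_simps(1) this \<open>0 < \<epsilon>\<close>] show ?thesis
        unfolding F_def H_def V_def using grid_simps[where n="Suc n" and s=s and t=t] by simp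
    qed
    with F_le have le: "2 * prob {\<omega>\<in>space M. 0 < V s \<omega> \<and> V t \<omega> < - \<epsilon>} \<le> prob {\<omega>\<in>E. 0 < V s \<omega>} + 2 * prob (H n)" for n
      by (smt (verit) field_sum_of_halves)
    have "(\<lambda>n. prob (H n)) \<longlonglongrightarrow> prob {}"
    proof (rule prob_LIMSEQ_AE)
      show "AE \<omega> in M. \<forall>\<^sub>F n in sequentially. (\<omega> \<in> H n) = (\<omega> \<in> {})"
        using cont
      proof eventually_elim
        case (elim \<omega>)
        from continuous_grid_increments_small[OF elim st(2) \<open>0 < \<epsilon>\<close>]
        show ?case
        proof eventually_elim
          case (elim n)
          have "\<bar>V (?g n (Suc k)) \<omega> - V (?g n k) \<omega>\<bar> < \<epsilon>" if k: "k \<in> {1..Suc n}" for k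
          proof -
            have "?g n k \<in> {s..t}" "?g n (Suc k) \<in> {s..t}"
              using grid_mem[of s t k "Suc n"] grid_mem[of s t "Suc k" "Suc n"] k st by auto
            moreover have "\<bar>?g n (Suc k) - ?g n k\<bar> \<le> (t - s) / real (Suc n)"
              using grid_simps(4)[of "Suc n" k s t] k st by simp
            ultimately show ?thesis using elim by blast
          qed
          then show ?case unfolding H_def by (auto simp: not_le[symmetric])
        qed
      qed
    qed measurable
    then have "(\<lambda>n. prob {\<omega>\<in>E. 0 < V s \<omega>} + 2 * prob (H n)) \<longlonglongrightarrow> prob {\<omega>\<in>E. 0 < V s \<omega>} + 2 * 0"
      by (intro tendsto_intros) simp
    then show ?thesis using le by (intro LIMSEQ_le_const[where a="2 * prob _"]) auto
  qed
  \<comment> \<open>Approaching 0 from below exhausts the strict inequality only; the absence of an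
    atom at 0 will close the gap to the upper bound.\<close>
  have "(\<lambda>n. prob {\<omega>\<in>space M. 0 < V s \<omega> \<and> V t \<omega> < - (1 / real (Suc n))}) \<longlonglongrightarrow> prob {\<omega>\<in>space M. 0 < V s \<omega> \<and> V t \<omega> < 0}"
  proof (rule prob_LIMSEQ_AE, measurable, intro AE_I2)
    fix \<omega>
    have "\<forall>\<^sub>F n in sequentially. (V t \<omega> < - (1 / real (Suc n))) = (V t \<omega> < 0)"
    proof (cases "V t \<omega> < 0")
      case False
      then have "\<not> V t \<omega> < - (1 / real (Suc n))" for n
        by (smt (verit) divide_pos_pos of_nat_0_less_iff zero_less_Suc)
      with False show ?thesis by simp
    next
      case True
      then have "\<forall>\<^sub>F n in sequentially. 1 / real (Suc n) < - V t \<omega>"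
        by (intro order_tendstoD[OF LIMSEQ_Suc[OF lim_const_over_n]]) auto
      then show ?thesis by eventually_elim (use True in auto)
    qed
    then show "\<forall>\<^sub>F n in sequentially. (\<omega> \<in> {\<omega>\<in>space M. 0 < V s \<omega> \<and> V t \<omega> < - (1 / real (Suc n))}) = (\<omega> \<in> {\<omega>\<in>space M. 0 < V s \<omega> \<and> V t \<omega> < 0})"
      by eventually_elim auto
  qed
  then have "(\<lambda>n. 2 * prob {\<omega>\<in>space M. 0 < V s \<omega> \<and> V t \<omega> < - (1 / real (Suc n))}) \<longlonglongrightarrow> 2 * prob {\<omega>\<in>space M. 0 < V s \<omega> \<and> V t \<omega> < 0}"
    by (intro tendsto_mult tendsto_const)
  then show ?thesis
    by (rule LIMSEQ_le_const2) (intro exI[of _ 0] allI impI bound, simp)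
qed

lemma (in prob_space) brownian_zero_reflection:
  fixes s t :: real
  assumes X: "standard_brownian_motion M X" and st: "0 < s" "s < t"
  defines "V \<equiv> \<lambda>r \<omega>. X r \<omega> - X 0 \<omega>"
  assumes E[measurable]: "E \<in> events" and E_iff: "AE \<omega> in M. \<omega> \<in> E \<longleftrightarrow> (\<exists>z. s < z \<and> z < t \<and> V z \<omega> = 0)"
  shows "prob {\<omega>\<in>E. 0 < V s \<omega>} = 2 * prob {\<omega>\<in>space M. 0 < V s \<omega> \<and> V t \<omega> < 0}"
proof -
  have [measurable]: "V s \<in> borel_measurable M" "V t \<in> borel_measurable M"
    unfolding V_def using brownian_measurable[OF X] st by (auto intro!: borel_measurable_diff)
  have z: "prob {\<omega>\<in>space M. V t \<omega> = 0} = 0"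
    unfolding V_def using st by (intro centered_normal_signs(1)[OF brownian_increment[OF X]]) auto
  have "prob {\<omega>\<in>space M. 0 < V s \<omega> \<and> V t \<omega> \<le> 0}
      \<le> prob ({\<omega>\<in>space M. 0 < V s \<omega> \<and> V t \<omega> < 0} \<union> {\<omega>\<in>space M. V t \<omega> = 0})"
    by (rule finite_measure_mono) auto
  also have "\<dots> \<le> prob {\<omega>\<in>space M. 0 < V s \<omega> \<and> V t \<omega> < 0} + prob {\<omega>\<in>space M. V t \<omega> = 0}"
    by (rule measure_Un_le) measurable
  finally have "prob {\<omega>\<in>space M. 0 < V s \<omega> \<and> V t \<omega> \<le> 0} \<le> prob {\<omega>\<in>space M. 0 < V s \<omega> \<and> V t \<omega> < 0}"
    using z by simp
  with brownian_zero_upper[OF X st E E_iff[unfolded V_def]] brownian_zero_lower[OF X st E E_iff[unfolded V_def]]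
  show ?thesis unfolding V_def by linarith
qed

section \<open>The probability of a zero in an interval\<close>

text \<open>Along the ray \<open>y = x * v\<close> the product of the two densities is a centered
  Gaussian \<open>C * exp (- a * x\<^sup>2)\<close>, and the extra factor \<open>x\<close>, the
  Jacobian of the substitution, gives it an elementary primitive.\<close>

lemma nn_integral_gaussian_ray:
  fixes s r v :: real
  assumes "0 < s" "0 < r"
  shows "(\<integral>\<^sup>+x. ennreal (x * (normal_density 0 (sqrt s) x * normal_density 0 (sqrt r) (x * v))) * indicator {0..} x \<partial>lborel)
       = ennreal (sqrt (s * r) / (2 * pi * (r + s * v\<^sup>2)))"
proof -
  define a where "a = (1 / s + v\<^sup>2 / r) / 2"
  define C where "C = 1 / (2 * pi * sqrt (s * r))"
  have a: "0 < a" using assms by (simp add: a_def add_pos_nonneg)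
  have eq: "normal_density 0 (sqrt s) x * normal_density 0 (sqrt r) (x * v) = C * exp (- a * x\<^sup>2)" for x
  proof -
    have "exp (- (x - 0)\<^sup>2 / (2 * (sqrt s)\<^sup>2)) * exp (- (x * v - 0)\<^sup>2 / (2 * (sqrt r)\<^sup>2)) = exp (- a * x\<^sup>2)"
      unfolding exp_add[symmetric] a_def using assms by (simp add: field_simps)
    moreover have "(1 / sqrt (2 * pi * (sqrt s)\<^sup>2)) * (1 / sqrt (2 * pi * (sqrt r)\<^sup>2)) = C"
    proof -
      have "sqrt (2 * pi * (sqrt s)\<^sup>2) * sqrt (2 * pi * (sqrt r)\<^sup>2) = sqrt ((2 * pi)\<^sup>2 * (s * r))"
        using assms by (simp add: real_sqrt_mult[symmetric] power2_eq_square ac_simps)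
      also have "\<dots> = 2 * pi * sqrt (s * r)"
        by (simp add: real_sqrt_mult)
      finally show ?thesis by (simp add: C_def)
    qed
    moreover have "p * e * (p' * e') = p * p' * (e * e')" for p e p' e' :: real
      by (simp only: ac_simps)
    ultimately show ?thesis unfolding normal_density_def by (simp only:)
  qed
  have "(\<integral>\<^sup>+x. ennreal (x * (C * exp (- a * x\<^sup>2))) * indicator {0..} x \<partial>lborel)
      = ennreal (0 - (- C / (2 * a) * exp (- a * 0\<^sup>2)))"
  proof (rule nn_integral_FTC_atLeast)
    show "((\<lambda>x. - C / (2 * a) * exp (- a * x\<^sup>2)) has_real_derivative x * (C * exp (- a * x\<^sup>2))) (at x)" for x
      using a by (auto intro!: derivative_eq_intros)
    have "LIM x at_top. a * x\<^sup>2 :> at_top"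
      using a by (intro filterlim_tendsto_pos_mult_at_top[OF tendsto_const] filterlim_pow_at_top filterlim_ident) auto
    then have "LIM x at_top. - a * x\<^sup>2 :> at_bot"
      by (simp add: filterlim_uminus_at_top)
    then have "((\<lambda>x. - C / (2 * a) * exp (- a * x\<^sup>2)) \<longlongrightarrow> - C / (2 * a) * 0) at_top"
      by (intro tendsto_mult tendsto_const filterlim_compose[OF exp_at_bot])
    then show "((\<lambda>x. - C / (2 * a) * exp (- a * x\<^sup>2)) \<longlongrightarrow> 0) at_top" by simp
    show "0 \<le> x * (C * exp (- a * x\<^sup>2))" if "0 \<le> x" for x
      using that assms by (auto simp: C_def)
  qed measurable
  also have "0 - (- C / (2 * a) * exp (- a * 0\<^sup>2)) = sqrt (s * r) / (2 * pi * (r + s * v\<^sup>2))"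
  proof -
    obtain q where q: "q = sqrt (s * r)" "0 < q" "q * q = s * r" using assms by simp
    then have "2 * a = (r + s * v\<^sup>2) / (q * q)"
      using assms by (simp add: a_def field_simps)
    then show ?thesis using q(2) unfolding C_def q(1)[symmetric] by simp
  qed
  finally show ?thesis unfolding eq .
qed

text \<open>Slopes replace the second coordinate: with \<open>y = - x * v\<close> the wedge becomes
  \<open>x > 0\<close>, \<open>v > 1\<close>. Integrating out \<open>x\<close> leaves a Cauchy-type
  density in \<open>v\<close>, which is where the arctangent comes from.\<close>

lemma nn_integral_gaussian_wedge:
  fixes s r :: real
  assumes s: "0 < s" and r: "0 < r"
  shows "(\<integral>\<^sup>+x. \<integral>\<^sup>+y. ennreal (normal_density 0 (sqrt s) x * normal_density 0 (sqrt r) y)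
            * indicator {(x, y). 0 < x \<and> x + y < 0} (x, y) \<partial>lborel \<partial>lborel)
       = ennreal (1 / 4 - arctan (sqrt (s / r)) / (2 * pi))"
proof -
  let ?f = "\<lambda>x y. normal_density 0 (sqrt s) x * normal_density 0 (sqrt r) y"
  let ?W = "{(x, y). 0 < x \<and> x + y < (0::real)}"
  have "(\<integral>\<^sup>+y. ennreal (?f x y) * indicator ?W (x, y) \<partial>lborel)
      = (\<integral>\<^sup>+v. ennreal (x * ?f x (x * v)) * indicator {0..} x * indicator {1..} v \<partial>lborel)" for x
  proof (cases "0 < x")
    case True
    have [measurable]: "(\<lambda>y. indicator ?W (x, y) :: ennreal) \<in> borel_measurable borel" by simp
    have "(\<integral>\<^sup>+y. ennreal (?f x y) * indicator ?W (x, y) \<partial>lborel)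
        = ennreal \<bar>- x\<bar> * (\<integral>\<^sup>+v. ennreal (?f x (0 + (- x) * v)) * indicator ?W (x, 0 + (- x) * v) \<partial>lborel)"
      using True by (intro nn_integral_real_affine) auto
    also have "\<dots> = (\<integral>\<^sup>+v. ennreal \<bar>- x\<bar> * (ennreal (?f x (0 + (- x) * v)) * indicator ?W (x, 0 + (- x) * v)) \<partial>lborel)"
      by (intro nn_integral_cmult[symmetric]) simp
    also have "\<dots> = (\<integral>\<^sup>+v. ennreal (x * ?f x (x * v)) * indicator {0..} x * indicator {1..} v \<partial>lborel)"
    \<comment> \<open>The slope 1 is the boundary ray \<open>x + y = 0\<close>; it lies outside the
      open wedge but inside the closed half-line \<open>{1..}\<close> required by the fundamental
      theorem.\<close>
    proof (rule nn_integral_cong_AE, use AE_lborel_singleton[of 1] in eventually_elim)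
      fix v :: real assume "v \<noteq> 1"
      have "indicator ?W (x, 0 + (- x) * v) = (indicator {1..} v :: ennreal)"
      proof -
        have "x + (- x) * v = x * (1 - v)" by (simp add: algebra_simps)
        then show ?thesis using True \<open>v \<noteq> 1\<close> by (auto simp: indicator_def mult_less_0_iff)
      qed
      moreover have "normal_density 0 (sqrt r) (0 + (- x) * v) = normal_density 0 (sqrt r) (x * v)"
        by (simp add: normal_density_def)
      ultimately show "ennreal \<bar>- x\<bar> * (ennreal (?f x (0 + (- x) * v)) * indicator ?W (x, 0 + (- x) * v))
          = ennreal (x * ?f x (x * v)) * indicator {0..} x * indicator {1..} v"
        using True by (simp add: ennreal_mult mult.assoc)
    qed
    finally show ?thesis .
  next
    case False
    then show ?thesis by (cases "x = 0") auto
  qed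
  then have "(\<integral>\<^sup>+x. \<integral>\<^sup>+y. ennreal (?f x y) * indicator ?W (x, y) \<partial>lborel \<partial>lborel)
      = (\<integral>\<^sup>+x. \<integral>\<^sup>+v. ennreal (x * ?f x (x * v)) * indicator {0..} x * indicator {1..} v \<partial>lborel \<partial>lborel)"
    by simp
  also have "\<dots> = (\<integral>\<^sup>+v. \<integral>\<^sup>+x. ennreal (x * ?f x (x * v)) * indicator {0..} x * indicator {1..} v \<partial>lborel \<partial>lborel)"
    by (rule lborel_pair.Fubini') measurable
  also have "\<dots> = (\<integral>\<^sup>+v. (\<integral>\<^sup>+x. ennreal (x * ?f x (x * v)) * indicator {0..} x \<partial>lborel) * indicator {1..} v \<partial>lborel)"
    by (intro nn_integral_cong nn_integral_multc) measurable
  also have "\<dots> = (\<integral>\<^sup>+v. ennreal (sqrt (s * r) / (2 * pi * (r + s * v\<^sup>2))) * indicator {1..} v \<partial>lborel)"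
    using s r by (simp only: nn_integral_gaussian_ray)
  \<comment> \<open>The primitive is \<open>arctan (v * sqrt (s / r)) / (2 * pi)\<close>, with limit
    1/4 at infinity; the factor \<open>1\<close> displays its value at the endpoint
    \<open>v = 1\<close>.\<close>
  also have "\<dots> = ennreal (1 / 4 - arctan (1 * sqrt (s / r)) / (2 * pi))"
  proof (rule nn_integral_FTC_atLeast)
    show "((\<lambda>v. arctan (v * sqrt (s / r)) / (2 * pi)) has_real_derivative sqrt (s * r) / (2 * pi * (r + s * v\<^sup>2))) (at v)" for v
    proof -
      have "((\<lambda>v. arctan (v * sqrt (s / r)) / (2 * pi)) has_real_derivative
          inverse (1 + (v * sqrt (s / r))\<^sup>2) * sqrt (s / r) / (2 * pi)) (at v)"
        by (auto intro!: derivative_eq_intros)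
      also have "inverse (1 + (v * sqrt (s / r))\<^sup>2) * sqrt (s / r) / (2 * pi) = sqrt (s * r) / (2 * pi * (r + s * v\<^sup>2))"
      proof -
        have "sqrt (s * r) = sqrt (s / r) * r"
          using r s by (simp add: real_sqrt_mult real_sqrt_divide field_simps)
        moreover have "1 + (v * sqrt (s / r))\<^sup>2 = (r + s * v\<^sup>2) / r"
          using r s by (simp add: power_mult_distrib field_simps)
        ultimately show ?thesis by (simp add: ac_simps)
      qed
      finally show ?thesis .
    qed
    have "LIM v at_top. v * sqrt (s / r) :> at_top"
      using s r by (intro filterlim_at_top_mult_tendsto_pos[OF tendsto_const _ filterlim_ident]) auto
    then have "((\<lambda>v. arctan (v * sqrt (s / r)) / (2 * pi)) \<longlongrightarrow> (pi / 2) / (2 * pi)) at_top"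
      by (intro tendsto_divide tendsto_const filterlim_compose[OF tendsto_arctan_at_top]) auto
    then show "((\<lambda>v. arctan (v * sqrt (s / r)) / (2 * pi)) \<longlongrightarrow> 1 / 4) at_top" by simp
    show "0 \<le> sqrt (s * r) / (2 * pi * (r + s * v\<^sup>2))" for v
      using s r by (auto intro!: divide_nonneg_nonneg mult_nonneg_nonneg add_nonneg_nonneg)
  qed measurable
  finally show ?thesis by simp
qed

context prob_space
begin

text \<open>The increments over the two intervals are independent Gaussians \<open>x\<close> and
  \<open>y\<close>; the signs of \<open>x\<close> and \<open>x + y\<close> describe the
  wedge.\<close>

lemma brownian_opposite_signs:
  assumes X: "standard_brownian_motion M X" and st: "0 < s" "s < t"
  shows "prob {\<omega>\<in>space M. 0 < X s \<omega> - X 0 \<omega> \<and> X t \<omega> - X 0 \<omega> < 0}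
       = 1 / 4 - arctan (sqrt (s / (t - s))) / (2 * pi)"
proof -
  define w where "w i = (if i = 0 then 0 else if i = Suc 0 then s else t)" for i :: nat
  define D where "D i \<omega> = X (w (Suc i)) \<omega> - X (w i) \<omega>" for i \<omega>
  have "\<forall>i<2. w i < w (Suc i)" "0 \<le> w 0" using st by (auto simp: w_def less_2_cases_iff)
  then have "indep_vars (\<lambda>_. borel) D {..<2}"
    using X unfolding standard_brownian_motion_def D_def by blast
  then have "indep_var (PiM {0} (\<lambda>_. borel)) (\<lambda>\<omega>. \<lambda>i\<in>{0}. D i \<omega>) (PiM {1} (\<lambda>_. borel)) (\<lambda>\<omega>. \<lambda>i\<in>{1}. D i \<omega>)"
    by (rule indep_var_restrict) auto
  then have "indep_var lborel ((\<lambda>d. d 0) \<circ> (\<lambda>\<omega>. \<lambda>i\<in>{0}. D i \<omega>)) lborel ((\<lambda>d. d 1) \<circ> (\<lambda>\<omega>. \<lambda>i\<in>{1}. D i \<omega>))"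
    by (rule indep_var_compose) (simp_all add: measurable_lborel2)
  moreover have "(\<lambda>d. d 0) \<circ> (\<lambda>\<omega>. \<lambda>i\<in>{0}. D i \<omega>) = (\<lambda>\<omega>. X s \<omega> - X 0 \<omega>)"
    "(\<lambda>d. d 1) \<circ> (\<lambda>\<omega>. \<lambda>i\<in>{1}. D i \<omega>) = (\<lambda>\<omega>. X t \<omega> - X s \<omega>)"
    by (simp_all add: fun_eq_iff D_def w_def)
  ultimately have ind: "indep_var lborel (\<lambda>\<omega>. X s \<omega> - X 0 \<omega>) lborel (\<lambda>\<omega>. X t \<omega> - X s \<omega>)"
    by simp
  have d: "distributed M lborel (\<lambda>\<omega>. X s \<omega> - X 0 \<omega>) (normal_density 0 (sqrt s))"
    "distributed M lborel (\<lambda>\<omega>. X t \<omega> - X s \<omega>) (normal_density 0 (sqrt (t - s)))"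
    using brownian_increment[OF X, of 0 s] brownian_increment[OF X, of s t] st by simp_all
  have J: "distributed M (lborel \<Otimes>\<^sub>M lborel) (\<lambda>\<omega>. (X s \<omega> - X 0 \<omega>, X t \<omega> - X s \<omega>))
      (\<lambda>(x, y). ennreal (normal_density 0 (sqrt s) x) * ennreal (normal_density 0 (sqrt (t - s)) y))"
    by (rule distributed_joint_indep[OF _ _ d ind]) (auto intro: lborel.sigma_finite_measure_axioms)
  let ?W = "{(x, y). 0 < x \<and> x + y < (0::real)}"
  have W: "?W \<in> sets (lborel \<Otimes>\<^sub>M lborel)"
  proof -
    have "{p \<in> space (lborel \<Otimes>\<^sub>M lborel). 0 < fst p \<and> fst p + snd p < (0::real)} \<in> sets (lborel \<Otimes>\<^sub>M lborel)"
      by measurable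
    moreover have "{p \<in> space (lborel \<Otimes>\<^sub>M lborel). 0 < fst p \<and> fst p + snd p < (0::real)} = ?W"
      by (auto simp: space_pair_measure)
    ultimately show ?thesis by simp
  qed
  have "emeasure M ((\<lambda>\<omega>. (X s \<omega> - X 0 \<omega>, X t \<omega> - X s \<omega>)) -` ?W \<inter> space M)
      = (\<integral>\<^sup>+p. (case p of (x, y) \<Rightarrow> ennreal (normal_density 0 (sqrt s) x) * ennreal (normal_density 0 (sqrt (t - s)) y))
          * indicator ?W p \<partial>(lborel \<Otimes>\<^sub>M lborel))"
    by (rule distributed_emeasure[OF J W])
  also have "\<dots> = (\<integral>\<^sup>+x. \<integral>\<^sup>+y. (case (x, y) of (x, y) \<Rightarrow> ennreal (normal_density 0 (sqrt s) x) * ennreal (normal_density 0 (sqrt (t - s)) y))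
          * indicator ?W (x, y) \<partial>lborel \<partial>lborel)"
  proof (rule lborel.nn_integral_fst[symmetric])
    have [measurable]: "(indicator ?W :: real \<times> real \<Rightarrow> ennreal) \<in> borel_measurable (lborel \<Otimes>\<^sub>M lborel)"
      using W by (rule borel_measurable_indicator)
    show "(\<lambda>p. (case p of (x, y) \<Rightarrow> ennreal (normal_density 0 (sqrt s) x) * ennreal (normal_density 0 (sqrt (t - s)) y))
          * indicator ?W p) \<in> borel_measurable (lborel \<Otimes>\<^sub>M lborel)"
      by measurable
  qed
  also have "\<dots> = ennreal (1 / 4 - arctan (sqrt (s / (t - s))) / (2 * pi))"
    using nn_integral_gaussian_wedge[of s "t - s"] st by (simp add: ennreal_mult)
  also have "(\<lambda>\<omega>. (X s \<omega> - X 0 \<omega>, X t \<omega> - X s \<omega>)) -` ?W \<inter> space M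
      = {\<omega>\<in>space M. 0 < X s \<omega> - X 0 \<omega> \<and> X t \<omega> - X 0 \<omega> < 0}"
    by auto
  finally have "emeasure M {\<omega>\<in>space M. 0 < X s \<omega> - X 0 \<omega> \<and> X t \<omega> - X 0 \<omega> < 0}
      = ennreal (1 / 4 - arctan (sqrt (s / (t - s))) / (2 * pi))" .
  \<comment> \<open>Nonnegativity of the difference is needed because \<open>ennreal\<close>
    truncates negative numbers to 0.\<close>
  moreover have "arctan (sqrt (s / (t - s))) / (2 * pi) \<le> (pi / 2) / (2 * pi)"
    using arctan_ubound[of "sqrt (s / (t - s))"] by (intro divide_right_mono) auto
  ultimately show ?thesis by (intro measure_eq_emeasure_eq_ennreal) auto
qed

lemma standard_brownian_motion_uminus:
  assumes X: "standard_brownian_motion M X"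
  shows "standard_brownian_motion M (\<lambda>s \<omega>. - X s \<omega>)"
  unfolding standard_brownian_motion_def
proof (intro conjI allI impI)
  show "(\<lambda>\<omega>. - X s \<omega>) \<in> borel_measurable M" if "0 \<le> s" for s
    using brownian_measurable[OF X that] by measurable
  have "AE \<omega> in M. X 0 \<omega> = 0" "AE \<omega> in M. continuous_on {0..} (\<lambda>s. X s \<omega>)"
    using X by (simp_all add: standard_brownian_motion_def)
  then show "AE \<omega> in M. - X 0 \<omega> = 0" "AE \<omega> in M. continuous_on {0..} (\<lambda>s. - X s \<omega>)"
    by (auto elim: eventually_mono intro: continuous_on_minus)
next
  fix k and u :: "nat \<Rightarrow> real" assume "0 \<le> u 0" "\<forall>i<k. u i < u (Suc i)"
  then have "indep_vars (\<lambda>_. borel) (\<lambda>i \<omega>. X (u (Suc i)) \<omega> - X (u i) \<omega>) {..<k}"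
    using X unfolding standard_brownian_motion_def by blast
  then have "indep_vars (\<lambda>_. borel) (\<lambda>i \<omega>. - (X (u (Suc i)) \<omega> - X (u i) \<omega>)) {..<k}"
    by (rule indep_vars_compose2) measurable
  then show "indep_vars (\<lambda>_. borel) (\<lambda>i \<omega>. - X (u (Suc i)) \<omega> - - X (u i) \<omega>) {..<k}" by simp
next
  fix s u :: real assume "0 \<le> s" "s < u"
  then have "distributed M lborel (\<lambda>\<omega>. 0 + (-1) * (X u \<omega> - X s \<omega>)) (normal_density (0 + (-1) * 0) (\<bar>-1\<bar> * sqrt (u - s)))"
    by (intro normal_density_affine brownian_increment[OF X]) auto
  then show "distributed M lborel (\<lambda>\<omega>. - X u \<omega> - - X s \<omega>) (normal_density 0 (sqrt (u - s)))"
    by simp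
qed

text \<open>The two signs at time \<open>s\<close> contribute equally, the negative one through the
  reflected motion \<open>- X\<close>; the value 0 at time \<open>s\<close> has probability
  0.\<close>

lemma brownian_prob_zero:
  fixes s t :: real
  assumes X: "standard_brownian_motion M X" and st: "0 < s" "s < t"
  assumes E[measurable]: "E \<in> events" and E_iff: "AE \<omega> in M. \<omega> \<in> E \<longleftrightarrow> (\<exists>z. s < z \<and> z < t \<and> X z \<omega> = 0)"
  shows "prob E = 1 - 2 / pi * arctan (sqrt (s / (t - s)))"
proof -
  let ?J = "1 / 4 - arctan (sqrt (s / (t - s))) / (2 * pi)"
  have [measurable]: "X s \<in> borel_measurable M" "X 0 \<in> borel_measurable M"
    using brownian_measurable[OF X] st by auto
  have "AE \<omega> in M. X 0 \<omega> = 0" using X by (simp add: standard_brownian_motion_def)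
  with E_iff have iff: "AE \<omega> in M. \<omega> \<in> E \<longleftrightarrow> (\<exists>z. s < z \<and> z < t \<and> X z \<omega> - X 0 \<omega> = 0)"
    by eventually_elim simp
  have neg: "AE \<omega> in M. \<omega> \<in> E \<longleftrightarrow> (\<exists>z. s < z \<and> z < t \<and> - X z \<omega> - - X 0 \<omega> = 0)"
  proof -
    have "- a - - b = 0 \<longleftrightarrow> a - b = 0" for a b :: real by linarith
    then show ?thesis using iff by (simp only:)
  qed
  have p: "prob {\<omega>\<in>E. 0 < X s \<omega> - X 0 \<omega>} = 2 * ?J"
    using brownian_zero_reflection[OF X st E iff] brownian_opposite_signs[OF X st] by simp
  have n: "prob {\<omega>\<in>E. 0 < - X s \<omega> - - X 0 \<omega>} = 2 * ?J"
    using brownian_zero_reflection[OF standard_brownian_motion_uminus[OF X] st E neg]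
      brownian_opposite_signs[OF standard_brownian_motion_uminus[OF X] st] by simp
  have "prob {\<omega>\<in>space M. X s \<omega> - X 0 \<omega> = 0} = 0"
    using st by (intro centered_normal_signs(1)[OF brownian_increment[OF X]]) auto
  then have nz: "AE \<omega> in M. X s \<omega> - X 0 \<omega> \<noteq> 0"
    by (subst (asm) prob_eq_0) (auto elim: eventually_mono)
  have "prob E = prob ({\<omega>\<in>E. 0 < X s \<omega> - X 0 \<omega>} \<union> {\<omega>\<in>E. 0 < - X s \<omega> - - X 0 \<omega>})"
    using nz by (intro finite_measure_eq_AE) (auto elim!: eventually_mono)
  also have "\<dots> = prob {\<omega>\<in>E. 0 < X s \<omega> - X 0 \<omega>} + prob {\<omega>\<in>E. 0 < - X s \<omega> - - X 0 \<omega>}"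
    by (rule finite_measure_Union) auto
  also have "\<dots> = 4 * ?J" unfolding p n by simp
  finally show ?thesis by (simp add: algebra_simps)
qed

end

section \<open>Moments of the last zero\<close>

text \<open>The same factor \<open>(2 * m + 1) / (2 * m + 2)\<close> governs the Gamma quotient,
  through its functional equation, and the integrals of even powers of sine. Both closed forms
  follow from it by induction.\<close>

lemma central_binomial_Suc:
  "real ((2 * Suc m) choose Suc m) * (1 / 2 ^ (2 * Suc m))
     = (2 * real m + 1) / (2 * real m + 2) * (real ((2 * m) choose m) * (1 / 2 ^ (2 * m)))"
proof -
  have b: "real ((2 * m) choose m) = fact (2 * m) / (fact m * fact m)" for m :: nat
    by (subst binomial_fact) auto
  have "fact (2 * Suc m) = (2 * real m + 2) * (2 * real m + 1) * fact (2 * m)"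
    by (simp add: algebra_simps)
  moreover have "fact (Suc m) = (real m + 1) * fact m" by simp
  ultimately show ?thesis unfolding b by (simp add: divide_simps) (simp add: algebra_simps)
qed

lemma Gamma_central_binomial:
  "Gamma (real m + 1/2) * Gamma (1/2) / Gamma (real m + 1) = pi * (real ((2 * m) choose m) * (1 / 2 ^ (2 * m)))"
proof (induction m)
  case 0
  show ?case by (simp add: Gamma_one_half_real)
next
  case (Suc m)
  have "Gamma (real (Suc m) + 1/2) = (real m + 1/2) * Gamma (real m + 1/2)"
    using Gamma_plus1[of "real m + 1/2"] by (simp add: add_ac nonpos_Ints_def field_simps)
  moreover have "Gamma (real (Suc m) + 1) = (real m + 1) * Gamma (real m + 1)"
    using Gamma_plus1[of "real m + 1"] by (simp add: add_ac nonpos_Ints_def)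
  ultimately have "Gamma (real (Suc m) + 1/2) * Gamma (1/2) / Gamma (real (Suc m) + 1)
      = (real m + 1/2) / (real m + 1) * (Gamma (real m + 1/2) * Gamma (1/2) / Gamma (real m + 1))"
    by simp
  also have "(real m + 1/2) / (real m + 1) = (2 * real m + 1) / (2 * real m + 2)"
    by (simp add: divide_simps)
  finally show ?case unfolding Suc.IH central_binomial_Suc by simp
qed

section \<open>The uniform angle and the moments of its squared sine\<close>

definition angle_measure :: "real measure" where
  "angle_measure = uniform_measure lborel {0..pi / 2}"

lemma prob_space_angle_measure: "prob_space angle_measure"
  unfolding angle_measure_def by (rule prob_space_uniform_measure) auto

lemma sets_angle_measure [measurable_cong, simp]: "sets angle_measure = sets borel"
  by (simp add: angle_measure_def)

lemma space_angle_measure [simp]: "space angle_measure = UNIV"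
  by (simp add: angle_measure_def)

lemma AE_angle_measure: "AE \<theta> in angle_measure. 0 \<le> \<theta> \<and> \<theta> \<le> pi / 2"
  unfolding angle_measure_def by (rule AE_uniform_measureI) auto

lemma measure_angle_measure_greaterThan:
  assumes "0 \<le> a" "a \<le> pi / 2"
  shows "measure angle_measure {a<..} = 1 - 2 / pi * a"
proof -
  have "{0..pi / 2} \<inter> {a<..} = {a<..pi / 2}" using assms by auto
  then show ?thesis
    unfolding angle_measure_def using assms by (subst measure_uniform_measure) (auto simp: field_simps)
qed

lemma integrable_sin_power:
  "integrable lborel (\<lambda>\<theta>. indicator {a..b} \<theta> * sin \<theta> ^ k :: real)"
proof -
  have "continuous_on {a..b} (\<lambda>\<theta>. sin \<theta> ^ k)" by (intro continuous_intros)
  then show ?thesis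
    using borel_integrable_atLeastAtMost'[of a b "\<lambda>\<theta>. sin \<theta> ^ k"] by (simp add: set_integrable_def)
qed

text \<open>The reduction formula comes from integrating the derivative of
  \<open>- (sin \<theta> ^ (2 * m + 1) * cos \<theta>)\<close>, which vanishes at both
  endpoints.\<close>

lemma lborel_integral_sin_power:
  "(\<integral>\<theta>. indicator {0..pi / 2} \<theta> * sin \<theta> ^ (2 * m) \<partial>lborel)
     = pi / 2 * (real ((2 * m) choose m) * (1 / 2 ^ (2 * m)))"
proof (induction m)
  case 0
  show ?case by simp
next
  case (Suc m)
  let ?I = "indicator {0..pi / 2} :: real \<Rightarrow> real"
  have "(\<integral>\<theta>. (real (2 * m + 2) * sin \<theta> ^ (2 * Suc m) - real (2 * m + 1) * sin \<theta> ^ (2 * m)) * ?I \<theta> \<partial>lborel)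
      = - (sin (pi / 2) ^ (2 * m + 1) * cos (pi / 2)) - - (sin 0 ^ (2 * m + 1) * cos 0)"
  proof (rule integral_FTC_Icc_real)
    show "((\<lambda>\<theta>. - (sin \<theta> ^ (2 * m + 1) * cos \<theta>)) has_real_derivative
        real (2 * m + 2) * sin \<theta> ^ (2 * Suc m) - real (2 * m + 1) * sin \<theta> ^ (2 * m)) (at \<theta>)" for \<theta>
    proof -
      have "((\<lambda>\<theta>. sin \<theta> ^ (2 * m + 1)) has_real_derivative real (2 * m + 1) * (cos \<theta> * sin \<theta> ^ (2 * m))) (at \<theta>)"
        using DERIV_power_Suc[where n="2 * m", OF DERIV_sin[of \<theta>]] by simp
      then have "((\<lambda>\<theta>. - (sin \<theta> ^ (2 * m + 1) * cos \<theta>)) has_real_derivative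
          - (real (2 * m + 1) * (cos \<theta> * sin \<theta> ^ (2 * m)) * cos \<theta> + - sin \<theta> * sin \<theta> ^ (2 * m + 1))) (at \<theta>)"
        by (intro DERIV_minus DERIV_mult DERIV_cos)
      also have "- (real (2 * m + 1) * (cos \<theta> * sin \<theta> ^ (2 * m)) * cos \<theta> + - sin \<theta> * sin \<theta> ^ (2 * m + 1))
          = sin \<theta> ^ (2 * m) * (sin \<theta> * sin \<theta> - real (2 * m + 1) * (cos \<theta> * cos \<theta>))"
        by (simp add: algebra_simps)
      also have "cos \<theta> * cos \<theta> = 1 - sin \<theta> * sin \<theta>"
        using sin_cos_squared_add[of \<theta>] by (simp add: power2_eq_square)
      also have "sin \<theta> ^ (2 * m) * (sin \<theta> * sin \<theta> - real (2 * m + 1) * (1 - sin \<theta> * sin \<theta>))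
          = real (2 * m + 2) * sin \<theta> ^ (2 * Suc m) - real (2 * m + 1) * sin \<theta> ^ (2 * m)"
        by (simp add: algebra_simps)
      finally show ?thesis .
    qed
  qed (auto intro!: continuous_intros)
  also have "(\<lambda>\<theta>. (real (2 * m + 2) * sin \<theta> ^ (2 * Suc m) - real (2 * m + 1) * sin \<theta> ^ (2 * m)) * ?I \<theta>)
      = (\<lambda>\<theta>. real (2 * m + 2) * (?I \<theta> * sin \<theta> ^ (2 * Suc m)) - real (2 * m + 1) * (?I \<theta> * sin \<theta> ^ (2 * m)))"
    by (rule ext) (simp add: indicator_def)
  also have "(\<integral>\<theta>. real (2 * m + 2) * (?I \<theta> * sin \<theta> ^ (2 * Suc m)) - real (2 * m + 1) * (?I \<theta> * sin \<theta> ^ (2 * m)) \<partial>lborel)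
      = real (2 * m + 2) * (\<integral>\<theta>. ?I \<theta> * sin \<theta> ^ (2 * Suc m) \<partial>lborel) - real (2 * m + 1) * (\<integral>\<theta>. ?I \<theta> * sin \<theta> ^ (2 * m) \<partial>lborel)"
    by (subst Bochner_Integration.integral_diff) (use integrable_sin_power in \<open>auto simp del: power_Suc mult_Suc_right\<close>)
  finally have "real (2 * m + 2) * (\<integral>\<theta>. ?I \<theta> * sin \<theta> ^ (2 * Suc m) \<partial>lborel)
      = real (2 * m + 1) * (\<integral>\<theta>. ?I \<theta> * sin \<theta> ^ (2 * m) \<partial>lborel)"
    by (simp only: sin_zero cos_pi_half) simp
  then have "(\<integral>\<theta>. ?I \<theta> * sin \<theta> ^ (2 * Suc m) \<partial>lborel)
      = (2 * real m + 1) / (2 * real m + 2) * (\<integral>\<theta>. ?I \<theta> * sin \<theta> ^ (2 * m) \<partial>lborel)"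
    by (simp add: field_simps)
  then show ?case unfolding Suc.IH central_binomial_Suc by (simp only: mult.left_commute)
qed

lemma nn_integral_angle_measure_sin_power:
  assumes "0 \<le> t"
  shows "(\<integral>\<^sup>+\<theta>. ennreal ((t * (sin \<theta>)\<^sup>2) ^ m) \<partial>angle_measure)
       = ennreal (real ((2 * m) choose m) * (1 / 2 ^ (2 * m)) * t ^ m)"
proof -
  let ?I = "indicator {0..pi / 2} :: real \<Rightarrow> real"
  have "(\<integral>\<^sup>+\<theta>. ennreal ((t * (sin \<theta>)\<^sup>2) ^ m) \<partial>angle_measure)
      = (\<integral>\<^sup>+\<theta>. ennreal ((t * (sin \<theta>)\<^sup>2) ^ m) * indicator {0..pi / 2} \<theta> \<partial>lborel) / ennreal (pi / 2)"
    unfolding angle_measure_def by (subst nn_integral_uniform_measure) auto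
  also have "(\<integral>\<^sup>+\<theta>. ennreal ((t * (sin \<theta>)\<^sup>2) ^ m) * indicator {0..pi / 2} \<theta> \<partial>lborel)
      = (\<integral>\<^sup>+\<theta>. ennreal (t ^ m * (?I \<theta> * sin \<theta> ^ (2 * m))) \<partial>lborel)"
    by (intro nn_integral_cong) (simp add: indicator_def power_mult_distrib power_mult)
  also have "\<dots> = ennreal (\<integral>\<theta>. t ^ m * (?I \<theta> * sin \<theta> ^ (2 * m)) \<partial>lborel)"
    using assms by (intro nn_integral_eq_integral integrable_mult_right integrable_sin_power) (auto simp: power_mult)
  also have "(\<integral>\<theta>. t ^ m * (?I \<theta> * sin \<theta> ^ (2 * m)) \<partial>lborel)
      = t ^ m * (pi / 2 * (real ((2 * m) choose m) * (1 / 2 ^ (2 * m))))"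
    by (simp only: lborel_integral_sin_power integral_mult_right_zero)
  also have "ennreal \<dots> / ennreal (pi / 2) = ennreal (t ^ m * (pi / 2 * (real ((2 * m) choose m) * (1 / 2 ^ (2 * m)))) / (pi / 2))"
    using assms by (intro divide_ennreal) auto
  also have "t ^ m * (pi / 2 * (real ((2 * m) choose m) * (1 / 2 ^ (2 * m)))) / (pi / 2)
      = real ((2 * m) choose m) * (1 / 2 ^ (2 * m)) * t ^ m"
    by simp
  finally show ?thesis .
qed

text \<open>Since sin(arctan x) = x / sqrt(1 + x^2), the angle \<open>?a\<close> satisfies
  \<open>t * (sin ?a)\<^sup>2 = s\<close>; sine is strictly increasing on the quarter period, so the
  event is that the angle exceeds \<open>?a\<close>.\<close>

lemma angle_measure_tail:
  assumes st: "0 < s" "s < t"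
  shows "measure angle_measure {\<theta>. s < t * (sin \<theta>)\<^sup>2} = 1 - 2 / pi * arctan (sqrt (s / (t - s)))"
proof -
  interpret prob_space angle_measure by (rule prob_space_angle_measure)
  let ?a = "arctan (sqrt (s / (t - s)))"
  have a: "0 \<le> ?a" "?a < pi / 2" using arctan_ubound st by auto
  have "1 + s / (t - s) = t / (t - s)" using st by (simp add: field_simps)
  then have sa: "t * (sin ?a)\<^sup>2 = s"
    unfolding sin_arctan using st by (simp add: power_divide)
  have "measure angle_measure {\<theta>. s < t * (sin \<theta>)\<^sup>2} = measure angle_measure {?a<..}"
  proof (rule finite_measure_eq_AE)
    show "AE \<theta> in angle_measure. \<theta> \<in> {\<theta>. s < t * (sin \<theta>)\<^sup>2} \<longleftrightarrow> \<theta> \<in> {?a<..}"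
      using AE_angle_measure
    proof eventually_elim
      case (elim \<theta>)
      then have "0 \<le> sin \<theta>" "0 \<le> sin ?a" using a by (auto intro!: sin_ge_zero)
      then have "(sin \<theta>)\<^sup>2 \<le> (sin ?a)\<^sup>2 \<longleftrightarrow> sin \<theta> \<le> sin ?a"
        by (intro power_mono_iff) auto
      then have sq: "(sin ?a)\<^sup>2 < (sin \<theta>)\<^sup>2 \<longleftrightarrow> sin ?a < sin \<theta>" by linarith
      have "s < t * (sin \<theta>)\<^sup>2 \<longleftrightarrow> t * (sin ?a)\<^sup>2 < t * (sin \<theta>)\<^sup>2" using sa by simp
      also have "\<dots> \<longleftrightarrow> sin ?a < sin \<theta>"
        using st by (simp only: mult_less_cancel_left_pos[of t] sq)
      also have "\<dots> \<longleftrightarrow> ?a < \<theta>"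
        using a elim pi_gt_zero by (intro sin_mono_less_eq; linarith)
      finally show ?case by simp
    qed
  qed measurable
  also have "\<dots> = 1 - 2 / pi * ?a"
    using a by (intro measure_angle_measure_greaterThan) auto
  finally show ?thesis .
qed

text \<open>The distribution functions of \<open>g\<close> and of
  \<open>t * (sin \<theta>)\<^sup>2\<close> agree, hence so do the laws and all moments. The case
  \<open>t = 0\<close> is included because an iterated time may be 0.\<close>

lemma (in prob_space) last_zero_moment:
  assumes X: "standard_brownian_motion M X" and "0 \<le> t"
    and g[measurable]: "g \<in> borel_measurable M"
    and g_eq: "AE \<omega> in M. g \<omega> = last_zero_before (\<lambda>s. X s \<omega>) t"
  shows "(\<integral>\<^sup>+\<omega>. ennreal (g \<omega> ^ m) \<partial>M) = ennreal (real ((2 * m) choose m) * (1 / 2 ^ (2 * m)) * t ^ m)"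
proof (cases "t = 0")
  case True
  have "last_zero_before f 0 = 0" for f unfolding last_zero_before_def by auto
  then have "(\<integral>\<^sup>+\<omega>. ennreal (g \<omega> ^ m) \<partial>M) = (\<integral>\<^sup>+\<omega>. ennreal (0 ^ m) \<partial>M)"
    using g_eq True by (intro nn_integral_cong_AE) auto
  also have "\<dots> = ennreal (0 ^ m)" by (simp add: emeasure_space_1)
  finally show ?thesis using True by (cases m) auto
next
  case False
  then have t: "0 < t" using \<open>0 \<le> t\<close> by simp
  interpret A: prob_space angle_measure by (rule prob_space_angle_measure)
  define h where "h \<theta> = t * (sin \<theta>)\<^sup>2" for \<theta>
  have h[measurable]: "h \<in> borel_measurable angle_measure" unfolding h_def by measurable
  let ?D1 = "distr M borel g" and ?D2 = "distr angle_measure borel h"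
  interpret D1: real_distribution ?D1 by (rule real_distribution_distr) simp
  interpret D2: real_distribution ?D2 by (rule A.real_distribution_distr) simp
  have c1: "cdf ?D1 s = 1 - prob {\<omega>\<in>space M. s < g \<omega>}" for s
  proof -
    have "cdf ?D1 s = prob {\<omega>\<in>space M. g \<omega> \<le> s}"
      unfolding cdf_def by (subst measure_distr) (auto intro!: arg_cong[where f=prob])
    also have "{\<omega>\<in>space M. g \<omega> \<le> s} = space M - {\<omega>\<in>space M. s < g \<omega>}" by auto
    also have "prob \<dots> = 1 - prob {\<omega>\<in>space M. s < g \<omega>}" by (rule prob_compl) measurable
    finally show ?thesis .
  qed
  have c2: "cdf ?D2 s = 1 - A.prob {\<theta>. s < h \<theta>}" for s
  proof -
    have "cdf ?D2 s = A.prob {\<theta>. h \<theta> \<le> s}"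
      unfolding cdf_def by (subst measure_distr) (auto intro!: arg_cong[where f=A.prob])
    also have "{\<theta>. h \<theta> \<le> s} = space angle_measure - {\<theta>. s < h \<theta>}" by auto
    also have "A.prob \<dots> = 1 - A.prob {\<theta>. s < h \<theta>}"
      by (rule A.prob_compl) measurable
    finally show ?thesis .
  qed
  have nz: "cdf ?D1 s = cdf ?D2 s" if s: "s \<noteq> 0" for s
  proof -
    consider "s < 0" | "0 < s" "s < t" | "t \<le> s" using s by fastforce
    then have "prob {\<omega>\<in>space M. s < g \<omega>} = A.prob {\<theta>. s < h \<theta>}"
    proof cases
      case 1
      have "prob {\<omega>\<in>space M. s < g \<omega>} = prob (space M)"
        using 1 g_eq last_zero_before_nonneg
        by (intro finite_measure_eq_AE) (auto elim!: eventually_mono intro: less_le_trans)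
      moreover have "{\<theta>. s < h \<theta>} = space angle_measure"
        using 1 t by (auto simp: h_def intro: less_le_trans)
      ultimately show ?thesis using prob_space A.prob_space by simp
    next
      case 2
      have "prob {\<omega>\<in>space M. s < g \<omega>} = 1 - 2 / pi * arctan (sqrt (s / (t - s)))"
      proof (rule brownian_prob_zero[OF X 2])
        show "AE \<omega> in M. \<omega> \<in> {\<omega>\<in>space M. s < g \<omega>} \<longleftrightarrow> (\<exists>z. s < z \<and> z < t \<and> X z \<omega> = 0)"
          using g_eq AE_space
          by eventually_elim (use less_last_zero_before_iff 2 in auto)
      qed measurable
      then show ?thesis unfolding h_def angle_measure_tail[OF 2] .
    next
      case 3
      have "\<not> s < last_zero_before f t" for f
        using less_last_zero_before_iff[of s f t] 3 t by auto
      then have "prob {\<omega>\<in>space M. s < g \<omega>} = prob {}"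
        using g_eq by (intro finite_measure_eq_AE) (auto elim!: eventually_mono)
      moreover have "\<not> s < h \<theta>" for \<theta>
      proof -
        have "t * (sin \<theta>)\<^sup>2 \<le> t * 1"
          using t by (intro mult_left_mono) (auto simp: abs_square_le_1)
        then show ?thesis using 3 by (simp add: h_def)
      qed
      ultimately show ?thesis by simp
    qed
    then show ?thesis unfolding c1 c2 by simp
  qed
  \<comment> \<open>The zero probability was computed for \<open>s > 0\<close> only, as the
    increment from 0 to \<open>s\<close> must have positive variance; right continuity supplies the
    point 0.\<close>
  have "cdf ?D1 0 = cdf ?D2 0"
  proof (rule tendsto_unique)
    show "(cdf ?D1 \<longlongrightarrow> cdf ?D1 0) (at_right 0)"
      using D1.cdf_is_right_cont[of 0] by (simp add: continuous_within)
    have "(cdf ?D2 \<longlongrightarrow> cdf ?D2 0) (at_right 0)"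
      using D2.cdf_is_right_cont[of 0] by (simp add: continuous_within)
    moreover have "\<forall>\<^sub>F s in at_right 0. cdf ?D2 s = cdf ?D1 s"
      using nz by (auto simp: eventually_at_filter)
    ultimately show "(cdf ?D1 \<longlongrightarrow> cdf ?D2 0) (at_right 0)"
      by (rule Lim_transform_eventually)
  qed simp
  then have "cdf ?D1 s = cdf ?D2 s" for s using nz by (cases "s = 0") auto
  then have "?D1 = ?D2"
    by (intro cdf_unique D1.real_distribution_axioms D2.real_distribution_axioms ext)
  have "(\<integral>\<^sup>+\<omega>. ennreal (g \<omega> ^ m) \<partial>M) = (\<integral>\<^sup>+x. ennreal (x ^ m) \<partial>?D1)"
    by (subst nn_integral_distr) auto
  also have "\<dots> = (\<integral>\<^sup>+\<theta>. ennreal (h \<theta> ^ m) \<partial>angle_measure)"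
    unfolding \<open>?D1 = ?D2\<close> by (subst nn_integral_distr) auto
  finally show ?thesis
    unfolding h_def nn_integral_angle_measure_sin_power[OF \<open>0 \<le> t\<close>] .
qed

section \<open>Iteration\<close>

primrec iterated_last_zero_rat :: "(nat \<Rightarrow> real \<Rightarrow> real) \<Rightarrow> nat \<Rightarrow> real \<Rightarrow> real" where
  "iterated_last_zero_rat f 0 t = t"
| "iterated_last_zero_rat f (Suc n) t = iterated_last_zero_rat f n (last_zero_rat (f (Suc n)) t)"

lemma iterated_last_zero_rat_nonneg: "0 \<le> t \<Longrightarrow> 0 \<le> iterated_last_zero_rat f n t"
  by (induction n arbitrary: t) (simp_all add: last_zero_rat_nonneg)

lemma iterated_last_zero_rat_cong:
  "(\<And>j. j \<in> {1..n} \<Longrightarrow> f j = g j) \<Longrightarrow> iterated_last_zero_rat f n t = iterated_last_zero_rat g n t"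
  by (induction n arbitrary: t) simp_all

lemma iterated_last_zero_rat_eq:
  assumes "\<And>j. 1 \<le> j \<Longrightarrow> continuous_on {0..} (f j)" "\<And>j. 1 \<le> j \<Longrightarrow> f j 0 = 0"
  shows "iterated_last_zero_rat (\<lambda>j. \<lambda>s\<in>{0..}. f j s) n t = iterated_last_zero f n t"
proof (induction n arbitrary: t)
  case (Suc n)
  have "last_zero_rat (\<lambda>s\<in>{0..}. f (Suc n) s) t = last_zero_rat (f (Suc n)) t"
    by (rule last_zero_rat_cong) simp
  also have "\<dots> = last_zero_before (f (Suc n)) t"
    using assms by (intro last_zero_rat_eq) auto
  finally show ?case by (simp only: iterated_last_zero_rat.simps iterated_last_zero.simps Suc)
qed simp

text \<open>The index set \<open>I\<close> stays fixed while \<open>n\<close> decreases, so that the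
  induction remains on one product space. Each step maps a pair (paths, time) to the same paths with
  an earlier time.\<close>

lemma measurable_iterated_last_zero_rat:
  assumes "{1..n} \<subseteq> I"
  shows "(\<lambda>(f, t). iterated_last_zero_rat f n t)
    \<in> borel_measurable (PiM I (\<lambda>_. PiM {0..} (\<lambda>_. borel)) \<Otimes>\<^sub>M borel)"
  using assms
proof (induction n)
  case (Suc n)
  let ?N = "PiM I (\<lambda>_. PiM {0..} (\<lambda>_. borel :: real measure)) \<Otimes>\<^sub>M (borel :: real measure)"
  have [measurable]: "(\<lambda>p. fst p (Suc n)) \<in> measurable ?N (PiM {0..} (\<lambda>_. borel))"
    using Suc.prems
    by (intro measurable_compose[OF measurable_fst measurable_component_singleton]) auto
  have IH: "(\<lambda>(f, t). iterated_last_zero_rat f n t) \<in> borel_measurable ?N"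
    using Suc.prems by (intro Suc.IH) auto
  have "(\<lambda>p. last_zero_rat (fst p (Suc n)) (snd p)) \<in> borel_measurable ?N"
    using measurable_compose[OF _ measurable_last_zero_rat, of "\<lambda>p. (fst p (Suc n), snd p)" ?N]
    by simp
  then have "(\<lambda>p. (fst p, last_zero_rat (fst p (Suc n)) (snd p))) \<in> measurable ?N ?N"
    by measurable
  from measurable_compose[OF this IH] show ?case
    by (simp add: case_prod_beta')
qed (simp add: case_prod_beta')

text \<open>The preimages under the two functions differ by a null set, and completeness makes every
  subset of a null set measurable.\<close>

lemma (in complete_measure) borel_measurable_cong_AE:
  fixes f g :: "'a \<Rightarrow> 'b::topological_space"
  assumes g: "g \<in> borel_measurable M" and eq: "AE x in M. f x = g x"
  shows "f \<in> borel_measurable M"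
proof (rule measurableI)
  fix S :: "'b set" assume "S \<in> sets borel"
  with g have "g -` S \<inter> space M \<in> sets M" by (rule measurable_sets)
  moreover have "AE x in M. x \<in> g -` S \<inter> space M \<longleftrightarrow> x \<in> f -` S \<inter> space M"
    using eq by eventually_elim auto
  ultimately show "f -` S \<inter> space M \<in> sets M"
    by (intro in_sets_AE[OF _ _ Int_lower2])
qed simp

section \<open>Fubini along independent paths, and transfer to the completion\<close>

context prob_space
begin

context
  fixes B :: "nat \<Rightarrow> real \<Rightarrow> 'a \<Rightarrow> real" and path :: "nat \<Rightarrow> 'a \<Rightarrow> real \<Rightarrow> real"
  assumes BM: "\<And>j. 1 \<le> j \<Longrightarrow> standard_brownian_motion M (B j)"
    and indep: "independent_processes M B {1..}"
  defines "path \<equiv> \<lambda>j \<omega>. \<lambda>s\<in>{0..}. B j s \<omega>"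
begin

lemma indep_paths: "indep_vars (\<lambda>_. PiM {0..} (\<lambda>_. borel)) path {1..}"
  using indep unfolding independent_processes_def path_def .

lemma measurable_path: "1 \<le> j \<Longrightarrow> path j \<in> measurable M (PiM {0..} (\<lambda>_. borel))"
  using indep_paths by (auto simp: indep_vars_def)

lemma measurable_iterated_path:
  "(\<lambda>\<omega>. iterated_last_zero_rat (\<lambda>j. path j \<omega>) n t) \<in> borel_measurable M"
proof -
  have "(\<lambda>\<omega>. (\<lambda>j\<in>{1..n}. path j \<omega>, t)) \<in> measurable M (PiM {1..n} (\<lambda>_. PiM {0..} (\<lambda>_. borel)) \<Otimes>\<^sub>M borel)"
    by (intro measurable_Pair measurable_restrict measurable_path) auto
  from measurable_compose[OF this measurable_iterated_last_zero_rat[OF subset_refl]]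
  have "(\<lambda>\<omega>. iterated_last_zero_rat (\<lambda>j\<in>{1..n}. path j \<omega>) n t) \<in> borel_measurable M" by simp
  moreover have "iterated_last_zero_rat (\<lambda>j\<in>{1..n}. path j \<omega>) n t = iterated_last_zero_rat (\<lambda>j. path j \<omega>) n t" for \<omega>
    by (rule iterated_last_zero_rat_cong) simp
  ultimately show ?thesis by simp
qed

lemma AE_regular_paths:
  "AE \<omega> in M. \<forall>j\<ge>1. continuous_on {0..} (\<lambda>s. B j s \<omega>) \<and> B j 0 \<omega> = 0"
proof -
  have "AE \<omega> in M. 1 \<le> j \<longrightarrow> continuous_on {0..} (\<lambda>s. B j s \<omega>) \<and> B j 0 \<omega> = 0" for j
    using BM[of j] by (cases "1 \<le> j") (auto simp: standard_brownian_motion_def)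
  then show ?thesis by (simp add: AE_all_countable)
qed

lemma AE_iterated_path:
  "AE \<omega> in M. iterated_last_zero_time B n t \<omega> = iterated_last_zero_rat (\<lambda>j. path j \<omega>) n t"
  using AE_regular_paths
proof eventually_elim
  case (elim \<omega>)
  then show ?case
    unfolding iterated_last_zero_time_def path_def
    by (intro iterated_last_zero_rat_eq[symmetric]) auto
qed

text \<open>The path with index \<open>Suc n\<close> acts first and is independent of the others.
  With it frozen, the remaining \<open>n\<close> steps start from a constant, so the induction
  hypothesis, stated for every nonnegative time, applies. Nonnegative integrals keep integrability
  out of the exchange.\<close>

lemma nn_integral_iterated_path:
  assumes "0 \<le> t"
  shows "(\<integral>\<^sup>+\<omega>. ennreal (iterated_last_zero_rat (\<lambda>j. path j \<omega>) n t ^ m) \<partial>M)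
    = ennreal ((real ((2 * m) choose m) * (1 / 2 ^ (2 * m))) ^ n * t ^ m)"
  using assms
proof (induction n arbitrary: t)
  case 0
  then show ?case by (simp add: emeasure_space_1)
next
  case (Suc n)
  define c where "c = real ((2 * m) choose m) * (1 / 2 ^ (2 * m))"
  have c: "0 \<le> c" by (simp add: c_def)
  let ?S = "PiM {0..} (\<lambda>_. borel :: real measure) :: (real \<Rightarrow> real) measure"
  let ?SS = "PiM {1..n} (\<lambda>_. ?S)"
  define X where "X \<omega> = (\<lambda>j\<in>{1..n}. path j \<omega>)" for \<omega>
  let ?T = "PiM {Suc n} (\<lambda>_. ?S)"
  define Y where "Y \<omega> = (\<lambda>j\<in>{Suc n}. path j \<omega>)" for \<omega>
  define F where "F = (\<lambda>p. ennreal (iterated_last_zero_rat (fst p) n (last_zero_rat (snd p (Suc n)) t) ^ m))"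
  have "indep_var ?SS X ?T Y"
    unfolding X_def Y_def by (rule indep_var_restrict[OF indep_paths]) auto
  then have X[measurable]: "X \<in> measurable M ?SS" and Y[measurable]: "Y \<in> measurable M ?T"
    and joint: "distr M ?SS X \<Otimes>\<^sub>M distr M ?T Y = distr M (?SS \<Otimes>\<^sub>M ?T) (\<lambda>\<omega>. (X \<omega>, Y \<omega>))"
    unfolding indep_var_distribution_eq by auto
  interpret DX: prob_space "distr M ?SS X" by (rule prob_space_distr) (rule X)
  interpret DY: prob_space "distr M ?T Y" by (rule prob_space_distr) (rule Y)
  interpret D: pair_sigma_finite "distr M ?SS X" "distr M ?T Y" ..
  have lz[measurable]: "(\<lambda>y. last_zero_rat (y (Suc n)) t) \<in> borel_measurable ?T"
    using measurable_compose[OF _ measurable_last_zero_rat, of "\<lambda>y. (y, t)" ?S] by simp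
  have F[measurable]: "F \<in> borel_measurable (?SS \<Otimes>\<^sub>M ?T)"
  proof -
    have "(\<lambda>p. (fst p, last_zero_rat (snd p (Suc n)) t)) \<in> measurable (?SS \<Otimes>\<^sub>M ?T) (?SS \<Otimes>\<^sub>M borel)"
      by measurable
    from measurable_compose[OF this measurable_iterated_last_zero_rat[OF subset_refl]]
    have "(\<lambda>p. iterated_last_zero_rat (fst p) n (last_zero_rat (snd p (Suc n)) t)) \<in> borel_measurable (?SS \<Otimes>\<^sub>M ?T)"
      by simp
    then show ?thesis unfolding F_def by measurable
  qed
  have XB: "iterated_last_zero_rat (X \<omega>) n r = iterated_last_zero_rat (\<lambda>j. path j \<omega>) n r" for \<omega> r
    unfolding X_def by (rule iterated_last_zero_rat_cong) simp
  have "(\<integral>\<^sup>+\<omega>. ennreal (iterated_last_zero_rat (\<lambda>j. path j \<omega>) (Suc n) t ^ m) \<partial>M) = (\<integral>\<^sup>+\<omega>. F (X \<omega>, Y \<omega>) \<partial>M)"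
    by (simp add: F_def XB Y_def)
  also have "\<dots> = (\<integral>\<^sup>+p. F p \<partial>(distr M ?SS X \<Otimes>\<^sub>M distr M ?T Y))"
    unfolding joint by (rule nn_integral_distr[symmetric]) measurable
  also have "\<dots> = (\<integral>\<^sup>+y. \<integral>\<^sup>+x. F (x, y) \<partial>distr M ?SS X \<partial>distr M ?T Y)"
    by (rule D.nn_integral_snd[symmetric]) measurable
  also have "\<dots> = (\<integral>\<^sup>+y. ennreal (c ^ n) * ennreal (last_zero_rat (y (Suc n)) t ^ m) \<partial>distr M ?T Y)"
  proof (rule nn_integral_cong)
    fix y assume "y \<in> space (distr M ?T Y)"
    then have y: "y \<in> space ?T" by simp
    have "(\<integral>\<^sup>+x. F (x, y) \<partial>distr M ?SS X) = (\<integral>\<^sup>+\<omega>. F (X \<omega>, y) \<partial>M)"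
      using y by (intro nn_integral_distr) measurable
    also have "\<dots> = (\<integral>\<^sup>+\<omega>. ennreal (iterated_last_zero_rat (\<lambda>j. path j \<omega>) n (last_zero_rat (y (Suc n)) t) ^ m) \<partial>M)"
      by (simp add: F_def XB)
    also have "\<dots> = ennreal (c ^ n * last_zero_rat (y (Suc n)) t ^ m)"
      unfolding c_def by (rule Suc.IH) (rule last_zero_rat_nonneg)
    also have "\<dots> = ennreal (c ^ n) * ennreal (last_zero_rat (y (Suc n)) t ^ m)"
      using c by (intro ennreal_mult) (auto simp: last_zero_rat_nonneg)
    finally show "(\<integral>\<^sup>+x. F (x, y) \<partial>distr M ?SS X) = ennreal (c ^ n) * ennreal (last_zero_rat (y (Suc n)) t ^ m)" .
  qed
  also have "\<dots> = ennreal (c ^ n) * (\<integral>\<^sup>+y. ennreal (last_zero_rat (y (Suc n)) t ^ m) \<partial>distr M ?T Y)"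
    by (rule nn_integral_cmult) measurable
  also have "(\<integral>\<^sup>+y. ennreal (last_zero_rat (y (Suc n)) t ^ m) \<partial>distr M ?T Y) = (\<integral>\<^sup>+\<omega>. ennreal (last_zero_rat (Y \<omega> (Suc n)) t ^ m) \<partial>M)"
    by (rule nn_integral_distr) measurable
  also have "\<dots> = ennreal (c * t ^ m)"
    unfolding c_def
  proof (rule last_zero_moment[OF BM \<open>0 \<le> t\<close>])
    show "AE \<omega> in M. last_zero_rat (Y \<omega> (Suc n)) t = last_zero_before (\<lambda>s. B (Suc n) s \<omega>) t"
      using AE_regular_paths
    proof eventually_elim
      case (elim \<omega>)
      have "last_zero_rat (Y \<omega> (Suc n)) t = last_zero_rat (\<lambda>s. B (Suc n) s \<omega>) t"
        unfolding Y_def path_def by (rule last_zero_rat_cong) simp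
      also have "\<dots> = last_zero_before (\<lambda>s. B (Suc n) s \<omega>) t"
        using elim by (intro last_zero_rat_eq) auto
      finally show ?case .
    qed
  qed (use measurable_compose[OF Y lz] in auto)
  also have "ennreal (c ^ n) * ennreal (c * t ^ m) = ennreal (c ^ Suc n * t ^ m)"
    using c Suc.prems by (subst ennreal_mult[symmetric]) (auto simp: ac_simps)
  finally show ?case unfolding c_def .
qed

text \<open>The iterated time itself is measurable only after completion; there it has the same
  integral as its measurable version, whose integral is unchanged by completing the measure.\<close>

lemma integral_iterated_last_zero_time:
  assumes "0 \<le> t"
  shows "(\<integral>\<omega>. iterated_last_zero_time B n t \<omega> ^ m \<partial>completion M)
    = (real ((2 * m) choose m) * (1 / 2 ^ (2 * m))) ^ n * t ^ m"
proof -
  let ?g = "\<lambda>\<omega>. iterated_last_zero_rat (\<lambda>j. path j \<omega>) n t"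
  note [measurable] = measurable_iterated_path
  have ae: "AE \<omega> in completion M. iterated_last_zero_time B n t \<omega> = ?g \<omega>"
    by (rule AE_completion[OF AE_iterated_path])
  have g: "?g \<in> borel_measurable (completion M)"
    by (rule measurable_completion) measurable
  have f: "iterated_last_zero_time B n t \<in> borel_measurable (completion M)"
    by (rule completion.borel_measurable_cong_AE[OF g ae])
  have "(\<integral>\<omega>. iterated_last_zero_time B n t \<omega> ^ m \<partial>completion M) = (\<integral>\<omega>. ?g \<omega> ^ m \<partial>completion M)"
    using f g ae by (intro integral_cong_AE borel_measurable_power) auto
  also have "\<dots> = (\<integral>\<omega>. ?g \<omega> ^ m \<partial>M)"
    by (rule integral_completion) measurable
  also have "\<dots> = enn2real (\<integral>\<^sup>+\<omega>. ennreal (?g \<omega> ^ m) \<partial>M)"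
    using assms by (intro integral_eq_nn_integral) (auto simp: iterated_last_zero_rat_nonneg)
  also have "\<dots> = (real ((2 * m) choose m) * (1 / 2 ^ (2 * m))) ^ n * t ^ m"
    unfolding nn_integral_iterated_path[OF assms] using assms by (intro enn2real_ennreal) auto
  finally show ?thesis .
qed

end

end

theorem mainTheorem10:
  fixes M :: "'a measure" and B :: "nat \<Rightarrow> real \<Rightarrow> 'a \<Rightarrow> real" and t :: real
  assumes "prob_space M"
    and "t > 0"
    and "\<And>j. j \<ge> 1 \<Longrightarrow> standard_brownian_motion M (B j)"
    and "independent_processes M B {1..}"
  shows "(\<forall>(m::nat) (n::nat). m \<ge> 1 \<longrightarrow> n \<ge> 1 \<longrightarrow>
            (\<integral>\<omega>. (iterated_last_zero_time B n t \<omega>) ^ m \<partial>completion M)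
              = (Gamma (real m + 1/2) * Gamma (1/2) / Gamma (real m + 1)) ^ n * (t ^ m / pi ^ n)
          \<and> (Gamma (real m + 1/2) * Gamma (1/2) / Gamma (real m + 1)) ^ n * (t ^ m / pi ^ n)
              = (real ((2 * m) choose m) * (1 / 2 ^ (2 * m))) ^ n * t ^ m)
       \<and> (\<forall>n::nat. n \<ge> 1 \<longrightarrow>
            (\<integral>\<omega>. iterated_last_zero_time B n t \<omega> \<partial>completion M) = t / 2 ^ n
          \<and> (\<integral>\<omega>. (iterated_last_zero_time B n t \<omega>)\<^sup>2 \<partial>completion M) = (3 / 8) ^ n * t\<^sup>2)
       \<and> (\<lambda>n. \<integral>\<omega>. (iterated_last_zero_time B n t \<omega> - 0)\<^sup>2 \<partial>completion M) \<longlonglongrightarrow> 0"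
proof -
  interpret prob_space M by fact
  have E: "(\<integral>\<omega>. iterated_last_zero_time B n t \<omega> ^ m \<partial>completion M)
      = (real ((2 * m) choose m) * (1 / 2 ^ (2 * m))) ^ n * t ^ m" for n m
    using assms by (intro integral_iterated_last_zero_time) auto
  \<comment> \<open>Each Gamma quotient is pi times the normalized central binomial, so
    \<open>pi ^ n\<close> cancels.\<close>
  have G: "(Gamma (real m + 1/2) * Gamma (1/2) / Gamma (real m + 1)) ^ n * (t ^ m / pi ^ n)
      = (real ((2 * m) choose m) * (1 / 2 ^ (2 * m))) ^ n * t ^ m" for n m
    unfolding Gamma_central_binomial power_mult_distrib by simp
  have E1: "(\<integral>\<omega>. iterated_last_zero_time B n t \<omega> \<partial>completion M) = t / 2 ^ n" for n
    using E[of n 1] by (simp add: power_one_over)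
  have E2: "(\<integral>\<omega>. (iterated_last_zero_time B n t \<omega>)\<^sup>2 \<partial>completion M) = (3 / 8) ^ n * t\<^sup>2" for n
  proof -
    have "real ((2 * 2) choose 2) * (1 / 2 ^ (2 * 2)) = 3 / 8" by (simp add: choose_two)
    then show ?thesis using E[of n 2] by simp
  qed
  have "(\<lambda>n. (3 / 8) ^ n * t\<^sup>2) \<longlonglongrightarrow> 0 * t\<^sup>2"
    by (intro tendsto_mult LIMSEQ_power_zero tendsto_const) simp
  then have "(\<lambda>n. \<integral>\<omega>. (iterated_last_zero_time B n t \<omega> - 0)\<^sup>2 \<partial>completion M) \<longlonglongrightarrow> 0"
    by (simp add: E2)
  with E G E1 E2 show ?thesis by simp
qed

end
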